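(* Let $p$ be a prime, let $H$ be a group, let $A=H$, let $B$ be a normal subgroup of $H$ of index $p$, and let $\theta:A\to B$ be an isomorphism. Let $G=H*_\theta$ be the corresponding HNN extension, and assume that $G$ is finitely generated. Then $$\Omega(G)\ge\frac{1+\sqrt5}{2}\quad\text{if } p=2,$$ $$\Omega(G)\ge\omega_k\quad\text{if } p=2k+1 \text{ is odd}.$$
   Context: For an isomorphism $\theta:A\to B$ between subgroups $A,B$ of a group $H$ with presentation $H=\langle S_H\mid R_H\rangle$, the HNN extension is $H*_\theta=\langle S_H,t\mid R_H,\ tat^{-1}=\theta(a)\ \forall a\in A\rangle$. For a finitely generated group $G$ and a finite generating set $S$ of $G$, let $\ell_{G,S}(g)$ be the minimal length of a word in $S\cup S^{-1}$ representing $g\in G$, let $F_{G,S}(n)$ be the number of $g\in G$ with $\ell_{G,S}(g)\le n$, and define the exponential growth rate $\omega(G,S)=\lim_{n\to\infty}F_{G,S}(n)^{1/n}$ (the limit exists). The minimal exponential growth rate is $\Omega(G)=\inf_S\omega(G,S)$, the infimum over all finite generating sets $S$ of $G$. For $k\ge1$, $\omega_k$ denotes the unique positive root of $T_k(x)=x^{k+1}-x^k-2x^{k-1}-\dots-2x-2=x^{k+1}-x^k-2\sum_{j=0}^{k-1}x^j$. *)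

theory Defs
  imports Complex_Main "HOL-Computational_Algebra.Primes" "HOL-Algebra.Generated_Groups"
begin

section \<open>Group presentations\<close>

text \<open>
  The letter \<open>(s, True)\<close> stands for the generator \<open>s\<close>, and \<open>(s, False)\<close> for its
  formal inverse.
\<close>

type_synonym 's gword = "('s \<times> bool) list"

definition words_over :: "'s set \<Rightarrow> 's gword set" where
  "words_over S = lists (S \<times> UNIV)"

definition inv_word :: "'s gword \<Rightarrow> 's gword" where
  "inv_word w = rev (map (map_prod id Not) w)"

text \<open>
  Two words are related if one is obtained from the other by inserting and deleting
  inverse pairs of letters and relators from \<open>R\<close>.  This is equality in the quotient of
  the free group on \<open>S\<close> by the normal closure of \<open>R\<close>.
\<close>

inductive pres_eq :: "'s set \<Rightarrow> 's gword set \<Rightarrow> 's gword \<Rightarrow> 's gword \<Rightarrow> bool"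
  for S :: "'s set" and R :: "'s gword set" where
  refl: "w \<in> words_over S \<Longrightarrow> pres_eq S R w w"
| sym: "pres_eq S R u v \<Longrightarrow> pres_eq S R v u"
| trans: "pres_eq S R u v \<Longrightarrow> pres_eq S R v w \<Longrightarrow> pres_eq S R u w"
| cancel: "u \<in> words_over S \<Longrightarrow> v \<in> words_over S \<Longrightarrow> s \<in> S \<Longrightarrow>
    pres_eq S R (u @ [(s, b), (s, \<not> b)] @ v) (u @ v)"
| relator: "u \<in> words_over S \<Longrightarrow> v \<in> words_over S \<Longrightarrow> r \<in> R \<Longrightarrow> r \<in> words_over S \<Longrightarrow>
    pres_eq S R (u @ r @ v) (u @ v)"

definition pres_rel :: "'s set \<Rightarrow> 's gword set \<Rightarrow> ('s gword \<times> 's gword) set" where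
  "pres_rel S R = {(u, v). pres_eq S R u v}"

definition word_class :: "'s set \<Rightarrow> 's gword set \<Rightarrow> 's gword \<Rightarrow> 's gword set" where
  "word_class S R w = pres_rel S R `` {w}"

definition presented_group :: "'s set \<Rightarrow> 's gword set \<Rightarrow> 's gword set monoid" where
  "presented_group S R =
    \<lparr> carrier = words_over S // pres_rel S R,
      mult = (\<lambda>X Y. \<Union>u\<in>X. \<Union>v\<in>Y. word_class S R (u @ v)),
      one = word_class S R [] \<rparr>"

lemma words_over_Nil [simp]: "[] \<in> words_over S"
  by (simp add: words_over_def)

lemma words_over_append [simp]:
  "u @ v \<in> words_over S \<longleftrightarrow> u \<in> words_over S \<and> v \<in> words_over S"
  by (auto simp: words_over_def)

lemma words_over_Cons [simp]:
  "x # w \<in> words_over S \<longleftrightarrow> fst x \<in> S \<and> w \<in> words_over S"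
  by (cases x) (auto simp: words_over_def)

lemma inv_word_in_words_over: "w \<in> words_over S \<Longrightarrow> inv_word w \<in> words_over S"
  by (induction w) (auto simp: inv_word_def)

lemma pres_eq_words_over:
  "pres_eq S R u v \<Longrightarrow> u \<in> words_over S \<and> v \<in> words_over S"
  by (induction rule: pres_eq.induct) auto

lemma equiv_pres_rel: "equiv (words_over S) (pres_rel S R)"
proof (rule equivI)
  show "pres_rel S R \<subseteq> words_over S \<times> words_over S"
    by (auto simp: pres_rel_def dest: pres_eq_words_over)
  show "refl_on (words_over S) (pres_rel S R)"
    by (simp add: pres_rel_def refl_on_def pres_eq.refl)
  show "Relation.sym (pres_rel S R)"
    unfolding pres_rel_def sym_def using pres_eq.sym by blast
  show "Relation.trans (pres_rel S R)"
    unfolding pres_rel_def trans_def using pres_eq.trans by blast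
qed

lemma pres_eq_context:
  "pres_eq S R u v \<Longrightarrow> x \<in> words_over S \<Longrightarrow> y \<in> words_over S \<Longrightarrow>
    pres_eq S R (x @ u @ y) (x @ v @ y)"
proof (induction rule: pres_eq.induct)
  case (refl w)
  then show ?case by (simp add: pres_eq.refl)
next
  case (sym u v)
  then show ?case by (simp add: pres_eq.sym)
next
  case (trans u v w)
  then show ?case using pres_eq.trans by blast
next
  case (cancel u v s b)
  then show ?case using pres_eq.cancel[of "x @ u" S "v @ y" s R b] by simp
next
  case (relator u v r)
  then show ?case using pres_eq.relator[of "x @ u" S "v @ y" r R] by simp
qed

lemma pres_eq_append:
  assumes "pres_eq S R u u'" "pres_eq S R v v'"
  shows "pres_eq S R (u @ v) (u' @ v')"
proof (rule pres_eq.trans)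
  note words = assms[THEN pres_eq_words_over]
  show "pres_eq S R (u @ v) (u' @ v)"
    using pres_eq_context[OF assms(1), of "[]" v] words by simp
  show "pres_eq S R (u' @ v) (u' @ v')"
    using pres_eq_context[OF assms(2), of u' "[]"] words by simp
qed

lemma pres_eq_inv_word: "w \<in> words_over S \<Longrightarrow> pres_eq S R (inv_word w @ w) []"
proof (induction w)
  case (Cons x w)
  obtain s b where x: "x = (s, b)" by (cases x)
  have "pres_eq S R (inv_word w @ [(s, \<not> b), (s, \<not> \<not> b)] @ w) (inv_word w @ w)"
    using Cons.prems x by (intro pres_eq.cancel inv_word_in_words_over) simp_all
  also have "inv_word w @ [(s, \<not> b), (s, \<not> \<not> b)] @ w = inv_word (x # w) @ x # w"
    using x by (simp add: inv_word_def)
  finally have "pres_eq S R (inv_word (x # w) @ x # w) (inv_word w @ w)" .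
  moreover have "pres_eq S R (inv_word w @ w) []"
    using Cons by simp
  ultimately show ?case by (rule pres_eq.trans)
qed (simp add: inv_word_def pres_eq.refl)

lemma word_class_eq_iff:
  "u \<in> words_over S \<Longrightarrow> v \<in> words_over S \<Longrightarrow>
    word_class S R u = word_class S R v \<longleftrightarrow> pres_eq S R u v"
  using eq_equiv_class_iff[OF equiv_pres_rel, of u S v R]
  unfolding word_class_def by (simp only: pres_rel_def mem_Collect_eq case_prod_conv)

lemma carrier_presented_group:
  "carrier (presented_group S R) = word_class S R ` words_over S"
  by (auto simp: presented_group_def word_class_def quotient_def)

lemma one_presented_group: "\<one>\<^bsub>presented_group S R\<^esub> = word_class S R []"
  by (simp add: presented_group_def)

lemma mult_presented_group:
  assumes "u \<in> words_over S" "v \<in> words_over S"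
  shows "word_class S R u \<otimes>\<^bsub>presented_group S R\<^esub> word_class S R v = word_class S R (u @ v)"
proof -
  have "word_class S R (u' @ v') = word_class S R (u @ v)"
    if "u' \<in> word_class S R u" "v' \<in> word_class S R v" for u' v'
  proof -
    have "pres_eq S R (u @ v) (u' @ v')"
      using that by (intro pres_eq_append) (simp_all add: word_class_def pres_rel_def)
    then show ?thesis
      using word_class_eq_iff pres_eq_words_over by (metis (no_types))
  qed
  moreover have "u \<in> word_class S R u" "v \<in> word_class S R v"
    using assms by (simp_all add: word_class_def pres_rel_def pres_eq.refl)
  ultimately have "(\<Union>u'\<in>word_class S R u. \<Union>v'\<in>word_class S R v. word_class S R (u' @ v')) =
      word_class S R (u @ v)"
    by blast
  then show ?thesis by (simp add: presented_group_def)
qed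

lemma group_presented_group: "group (presented_group S R)"
proof (rule groupI)
  let ?P = "presented_group S R"
  show "X \<otimes>\<^bsub>?P\<^esub> Y \<in> carrier ?P" if "X \<in> carrier ?P" "Y \<in> carrier ?P" for X Y
    using that by (auto simp: carrier_presented_group mult_presented_group)
  show "\<one>\<^bsub>?P\<^esub> \<in> carrier ?P"
    by (simp add: carrier_presented_group one_presented_group)
  show "X \<otimes>\<^bsub>?P\<^esub> Y \<otimes>\<^bsub>?P\<^esub> Z = X \<otimes>\<^bsub>?P\<^esub> (Y \<otimes>\<^bsub>?P\<^esub> Z)"
    if "X \<in> carrier ?P" "Y \<in> carrier ?P" "Z \<in> carrier ?P" for X Y Z
    using that by (auto simp: carrier_presented_group mult_presented_group)
  fix X assume "X \<in> carrier ?P"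
  then obtain w where w: "w \<in> words_over S" "X = word_class S R w"
    by (auto simp: carrier_presented_group)
  show "\<one>\<^bsub>?P\<^esub> \<otimes>\<^bsub>?P\<^esub> X = X"
    using w by (simp add: one_presented_group mult_presented_group)
  have "word_class S R (inv_word w) \<otimes>\<^bsub>?P\<^esub> X = \<one>\<^bsub>?P\<^esub>"
    using w pres_eq_inv_word[OF w(1)] inv_word_in_words_over[OF w(1)]
    by (simp add: one_presented_group mult_presented_group word_class_eq_iff)
  moreover have "word_class S R (inv_word w) \<in> carrier ?P"
    using inv_word_in_words_over[OF w(1)] by (simp add: carrier_presented_group)
  ultimately show "\<exists>Y\<in>carrier ?P. Y \<otimes>\<^bsub>?P\<^esub> X = \<one>\<^bsub>?P\<^esub>" by blast
qed


section \<open>HNN extensions\<close>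

text \<open>
  The presentation \<open>H = \<langle>S | R\<rangle>\<close> is given by an isomorphism \<open>\<phi>\<close> from \<open>presented_group S R\<close>
  to \<open>H\<close>, so a word \<open>w\<close> over \<open>S\<close> represents the element \<open>\<phi> (word_class S R w)\<close> of \<open>H\<close>.
\<close>

definition is_presentation ::
  "'s set \<Rightarrow> 's gword set \<Rightarrow> ('s gword set \<Rightarrow> 'h) \<Rightarrow> ('h, 'm) monoid_scheme \<Rightarrow> bool" where
  "is_presentation S R \<phi> H \<longleftrightarrow> R \<subseteq> words_over S \<and> \<phi> \<in> iso (presented_group S R) H"

text \<open>
  The stable letter \<open>t\<close> is \<open>None\<close>, and a generator \<open>s\<close> of \<open>H\<close> becomes \<open>Some s\<close>.  The
  relation \<open>t a t\<inverse> = \<theta>(a)\<close> is written as the relator \<open>t w t\<inverse> w'\<inverse>\<close> for all words \<open>w\<close>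
  and \<open>w'\<close> representing \<open>a\<close> and \<open>\<theta>(a)\<close>, so no representatives have to be chosen.
\<close>

definition embed_word :: "'s gword \<Rightarrow> 's option gword" where
  "embed_word w = map (map_prod Some id) w"

definition hnn_relators ::
  "'s set \<Rightarrow> 's gword set \<Rightarrow> ('s gword set \<Rightarrow> 'h) \<Rightarrow> 'h set \<Rightarrow> ('h \<Rightarrow> 'h) \<Rightarrow> 's option gword set" where
  "hnn_relators S R \<phi> A \<theta> =
    {[(None, True)] @ embed_word w @ [(None, False)] @ inv_word (embed_word w') | w w'.
      w \<in> words_over S \<and> w' \<in> words_over S \<and> \<phi> (word_class S R w) \<in> A \<and>
      \<phi> (word_class S R w') = \<theta> (\<phi> (word_class S R w))}"

definition hnn_extension ::
  "'s set \<Rightarrow> 's gword set \<Rightarrow> ('s gword set \<Rightarrow> 'h) \<Rightarrow> 'h set \<Rightarrow> ('h \<Rightarrow> 'h) \<Rightarrow>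
    's option gword set monoid" where
  "hnn_extension S R \<phi> A \<theta> =
    presented_group (insert None (Some ` S)) (embed_word ` R \<union> hnn_relators S R \<phi> A \<theta>)"


section \<open>Exponential growth rates\<close>

definition fin_gen_sets :: "('a, 'm) monoid_scheme \<Rightarrow> 'a set set" where
  "fin_gen_sets G = {S. finite S \<and> S \<subseteq> carrier G \<and> generate G S = carrier G}"

definition finitely_generated :: "('a, 'm) monoid_scheme \<Rightarrow> bool" where
  "finitely_generated G \<longleftrightarrow> fin_gen_sets G \<noteq> {}"

definition word_length :: "('a, 'm) monoid_scheme \<Rightarrow> 'a set \<Rightarrow> 'a \<Rightarrow> nat" where
  "word_length G S g =
    (LEAST n. \<exists>w. length w = n \<and> set w \<subseteq> S \<union> m_inv G ` S \<and> foldr (mult G) w (one G) = g)"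

definition growth_function :: "('a, 'm) monoid_scheme \<Rightarrow> 'a set \<Rightarrow> nat \<Rightarrow> nat" where
  "growth_function G S n = card {g \<in> carrier G. word_length G S g \<le> n}"

definition growth_rate :: "('a, 'm) monoid_scheme \<Rightarrow> 'a set \<Rightarrow> real" where
  "growth_rate G S = lim (\<lambda>n. root n (real (growth_function G S n)))"

definition min_growth_rate :: "('a, 'm) monoid_scheme \<Rightarrow> real" where
  "min_growth_rate G = (INF S\<in>fin_gen_sets G. growth_rate G S)"

definition T_poly :: "nat \<Rightarrow> real \<Rightarrow> real" where
  "T_poly k x = x ^ (k + 1) - x ^ k - 2 * (\<Sum>j<k. x ^ j)"

definition omega_root :: "nat \<Rightarrow> real" where
  "omega_root k = (THE x. x > 0 \<and> T_poly k x = 0)"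

end

theory Submission
  imports Defs "HOL-Algebra.Bij" "HOL-Algebra.Elementary_Groups" "HOL-Algebra.Multiplicative_Group"
begin

text \<open>
  Write \<open>t\<close> for the stable letter, so that \<open>t H t\<inverse> = B \<subseteq> H\<close>.  The group \<open>G\<close> acts on its
  Bass-Serre tree, in which every vertex has one parent and \<open>p\<close> children, and it fixes the end
  reached by passing to parents.  The exponent sum of \<open>t\<close> is a height homomorphism
  \<open>G \<rightarrow> \<int>\<close>.  Elements of positive height are hyperbolic and move down along an axis, elements
  of height \<open>0\<close> are elliptic.  The tree itself is not constructed.  It enters through the
  monoid \<open>M = {h t\<^sup>j | h \<in> H, j \<ge> 0}\<close> of elements that move the base vertex weakly down,
  and through the map \<open>D\<close>, which sends \<open>h t\<^sup>j\<close> with \<open>j > 0\<close> to the coset \<open>h B\<close>, that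
  is, to the child of the base vertex below which the image of the base vertex lies.

  A finite generating set \<open>S\<close> cannot preserve a line.  So at some vertex (lemma \<open>diverge\<close>)
  there are a generator \<open>x\<close> with this vertex on its axis and another generator
  (both up to inversion) that is either an elliptic \<open>a\<close> fixing this vertex but
  moving its children, or a hyperbolic \<open>y\<close> whose axis leaves that of \<open>x\<close> there.
  Elements that move a vertex into disjoint subtrees below it generate a free monoid, and if
  their lengths \<open>l\<^sub>i\<close> satisfy \<open>\<Sum>\<^sub>i z\<^bsup>l\<^sub>i\<^esup> \<ge> 1\<close> then the growth rate is at least
  \<open>1 / z\<close> (lemma \<open>growth_rate_code\<close>).

  In the elliptic case the elements \<open>a\<^sup>i x\<close> for \<open>|i| \<le> k\<close> serve, of length \<open>|i| + 1\<close> (for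
  \<open>p = 2\<close>, \<open>x\<close> and \<open>a x\<close>).  The equation \<open>z + 2 (z\<^sup>2 + \<dots> + z\<^bsup>k+1\<^esup>) = 1\<close> is
  \<open>T\<^sub>k(1/z) = 0\<close>.  If \<open>x\<close> and \<open>y\<close> have equal heights and \<open>p\<close> is odd, then \<open>a = y x\<inverse>\<close> is elliptic, and
  \<open>a\<^sup>i x\<close> has length \<open>1, 1, 3, 3, 5, \<dots>\<close>, which is at least as good.  If the heights
  differ and \<open>p > 3\<close>, explicit codes of words in \<open>x\<close> and \<open>y\<close> give the bound
  \<open>1 + \<surd>2\<close>, which is at least \<open>\<omega>\<^sub>k\<close>.  For \<open>p = 3\<close> and
  different heights, and for \<open>p = 2\<close>, the free monoid on \<open>x\<close> and \<open>y\<close> suffices.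

  That \<open>H\<close> embeds in \<open>G\<close>, so that \<open>B\<close> keeps its index, follows from an action of \<open>G\<close>
  on \<open>H \<times> \<nat>\<close> in which \<open>H\<close> acts freely.
\<close>

section \<open>Exponential growth rates\<close>

text \<open>
  The ball of radius \<open>n\<close> in the word metric of \<open>S\<close>, as the set of values of words.
\<close>
definition reach :: "('a, 'm) monoid_scheme \<Rightarrow> 'a set \<Rightarrow> nat \<Rightarrow> 'a set" where
  "reach G S n = {foldr (mult G) w (one G) | w. length w \<le> n \<and> set w \<subseteq> S \<union> m_inv G ` S}"

text \<open>
  Fekete's lemma in multiplicative form.
\<close>
lemma fekete_root_convergent:
  fixes F :: "nat \<Rightarrow> real"
  assumes pos: "\<And>n. F n \<ge> 1" and submult: "\<And>m n. F (m + n) \<le> F m * F n"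
  shows "convergent (\<lambda>n. root n (F n))"
proof -
  define a where "a n = ln (F n)" for n
  have a0: "a n \<ge> 0" for n
    unfolding a_def using pos[of n] by simp
  have asub: "a (m + n) \<le> a m + a n" for m n
  proof -
    have "ln (F (m + n)) \<le> ln (F m * F n)"
      using submult[of m n] pos[of "m + n"] by (intro ln_mono) auto
    also have "\<dots> = ln (F m) + ln (F n)"
      using pos[of m] pos[of n] by (simp add: ln_mult)
    finally show ?thesis unfolding a_def .
  qed
  have amul: "a (q * k + r) \<le> real k * a q + a r" for q k r
  proof (induction k)
    case (Suc k)
    have "a (q * Suc k + r) = a (q + (q * k + r))" by (simp add: algebra_simps)
    also have "\<dots> \<le> a q + a (q * k + r)" by (rule asub)
    finally show ?case using Suc by (simp add: algebra_simps)
  qed simp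
  define L where "L = (INF n\<in>{1..}. a n / real n)"
  have bdd: "bdd_below ((\<lambda>n. a n / real n) ` {1..})"
    by (rule bdd_belowI[of _ 0]) (auto simp: a0)
  have "(\<lambda>n. a n / real n) \<longlonglongrightarrow> L"
  proof (rule LIMSEQ_I)
    fix e :: real assume "e > 0"
    have "\<exists>x\<in>(\<lambda>n. a n / real n) ` {1..}. x < L + e / 2"
      unfolding L_def using \<open>e > 0\<close> bdd by (subst cInf_less_iff[symmetric]) auto
    then obtain q where q: "q \<ge> 1" "a q / real q < L + e / 2" by auto
    define C where "C = (\<Sum>r<q. a r)"
    have C: "a r \<le> C" if "r < q" for r
      unfolding C_def using that a0 by (intro member_le_sum) auto
    obtain N :: nat where N: "real N > 2 * C / e" using reals_Archimedean2 by blast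
    show "\<exists>N. \<forall>n\<ge>N. norm (a n / real n - L) < e"
    proof (intro exI allI impI)
      fix n assume n: "n \<ge> max N 1"
      have "a n = a (q * (n div q) + n mod q)" by simp
      also have "\<dots> \<le> real (n div q) * a q + C"
        using amul[of q "n div q" "n mod q"] C[of "n mod q"] q(1) by simp
      also have "real (n div q) * a q \<le> (real n / real q) * a q"
      proof (intro mult_right_mono a0)
        have "real (n div q) * real q \<le> real n"
          by (metis div_times_less_eq_dividend of_nat_le_iff of_nat_mult)
        then show "real (n div q) \<le> real n / real q" using q(1) by (simp add: field_simps)
      qed
      finally have "a n / real n \<le> ((real n / real q) * a q + C) / real n"
        using n by (intro divide_right_mono) auto
      also have "\<dots> = a q / real q + C / real n" using n by (simp add: field_simps)
      also have "C / real n < e / 2"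
      proof -
        have "2 * C / e < real n" using N n by linarith
        then show ?thesis using \<open>e > 0\<close> n by (simp add: field_simps)
      qed
      finally have "a n / real n < L + e" using q(2) by simp
      moreover have "L \<le> a n / real n"
        unfolding L_def using n by (intro cINF_lower bdd) auto
      ultimately show "norm (a n / real n - L) < e" by simp
    qed
  qed
  then have "(\<lambda>n. exp (a n / real n)) \<longlonglongrightarrow> exp L" by (intro tendsto_intros)
  moreover have "eventually (\<lambda>n. exp (a n / real n) = root n (F n)) sequentially"
    using eventually_gt_at_top[of 0]
  proof eventually_elim
    case (elim n)
    have F: "F n > 0" using pos[of n] by linarith
    have "exp (a n / real n) ^ n = exp (a n)"
      using elim by (simp flip: exp_of_nat_mult)
    then show ?case
      using elim F by (intro real_root_pos_unique[symmetric]) (auto simp: a_def)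
  qed
  ultimately have "(\<lambda>n. root n (F n)) \<longlonglongrightarrow> exp L"
    by (rule Lim_transform_eventually)
  then show ?thesis by (auto simp: convergent_def)
qed

context group
begin

lemma inv_cancel_left [simp]:
  "x \<in> carrier G \<Longrightarrow> z \<in> carrier G \<Longrightarrow> inv x \<otimes> (x \<otimes> z) = z"
  "x \<in> carrier G \<Longrightarrow> z \<in> carrier G \<Longrightarrow> x \<otimes> (inv x \<otimes> z) = z"
  by (simp_all flip: m_assoc)

lemma foldr_mult_closed: "set w \<subseteq> carrier G \<Longrightarrow> foldr (\<otimes>) w \<one> \<in> carrier G"
  by (induction w) auto

lemma foldr_mult_append:
  "set v \<subseteq> carrier G \<Longrightarrow> set w \<subseteq> carrier G \<Longrightarrow>
    foldr (\<otimes>) (v @ w) \<one> = foldr (\<otimes>) v \<one> \<otimes> foldr (\<otimes>) w \<one>"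
proof (induction v)
  case (Cons a v)
  then show ?case using foldr_mult_closed[of v] foldr_mult_closed[of w] by (simp add: m_assoc)
qed (simp add: foldr_mult_closed)

context
  fixes S :: "'a set"
  assumes S: "S \<subseteq> carrier G"
begin

lemma letters_closed: "S \<union> m_inv G ` S \<subseteq> carrier G"
  using S by auto

lemma reach_closed: "reach G S n \<subseteq> carrier G"
  unfolding reach_def using foldr_mult_closed letters_closed by blast

lemma one_in_reach: "\<one> \<in> reach G S n"
  unfolding reach_def by (intro CollectI exI[of _ "[]"]) simp

lemma letter_in_reach: "s \<in> S \<union> m_inv G ` S \<Longrightarrow> s \<in> reach G S 1"
  unfolding reach_def using letters_closed
  by (intro CollectI exI[of _ "[s]"]) (auto simp: subset_iff)

lemma reach_mult:
  assumes "g \<in> reach G S m" "h \<in> reach G S n"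
  shows "g \<otimes> h \<in> reach G S (m + n)"
proof -
  from assms obtain v w where
    v: "g = foldr (\<otimes>) v \<one>" "length v \<le> m" "set v \<subseteq> S \<union> m_inv G ` S" and
    w: "h = foldr (\<otimes>) w \<one>" "length w \<le> n" "set w \<subseteq> S \<union> m_inv G ` S"
    unfolding reach_def by auto
  have "g \<otimes> h = foldr (\<otimes>) (v @ w) \<one>"
    unfolding v(1) w(1) using v(3) w(3) letters_closed
    by (intro foldr_mult_append[symmetric]) blast+
  then show ?thesis
    unfolding reach_def using v w by (intro CollectI exI[of _ "v @ w"]) simp
qed

lemma reach_split:
  assumes "g \<in> reach G S (m + n)"
  shows "\<exists>u\<in>reach G S m. \<exists>v\<in>reach G S n. g = u \<otimes> v"
proof -
  from assms obtain w where
    w: "g = foldr (\<otimes>) w \<one>" "length w \<le> m + n" "set w \<subseteq> S \<union> m_inv G ` S"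
    unfolding reach_def by auto
  have sub: "set (take m w) \<subseteq> S \<union> m_inv G ` S" "set (drop m w) \<subseteq> S \<union> m_inv G ` S"
    using w(3) set_take_subset[of m w] set_drop_subset[of m w] by blast+
  have "g = foldr (\<otimes>) (take m w @ drop m w) \<one>" using w(1) by simp
  also have "\<dots> = foldr (\<otimes>) (take m w) \<one> \<otimes> foldr (\<otimes>) (drop m w) \<one>"
    using sub letters_closed by (intro foldr_mult_append) blast+
  finally have "g = foldr (\<otimes>) (take m w) \<one> \<otimes> foldr (\<otimes>) (drop m w) \<one>" .
  moreover have "foldr (\<otimes>) (take m w) \<one> \<in> reach G S m"
    unfolding reach_def using sub(1) by (intro CollectI exI[of _ "take m w"]) simp
  moreover have "foldr (\<otimes>) (drop m w) \<one> \<in> reach G S n"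
    unfolding reach_def using sub(2) w(2) by (intro CollectI exI[of _ "drop m w"]) auto
  ultimately show ?thesis by blast
qed

lemma finite_reach: "finite S \<Longrightarrow> finite (reach G S n)"
proof -
  assume "finite S"
  then have "finite {w. set w \<subseteq> S \<union> m_inv G ` S \<and> length w \<le> n}"
    by (intro finite_lists_length_le) simp
  then have "finite ((\<lambda>w. foldr (\<otimes>) w \<one>) ` {w. set w \<subseteq> S \<union> m_inv G ` S \<and> length w \<le> n})"
    by simp
  then show ?thesis by (rule finite_subset[rotated]) (auto simp: reach_def)
qed

lemma generate_reach: "g \<in> generate G S \<Longrightarrow> \<exists>n. g \<in> reach G S n"
proof (induction rule: generate.induct)
  case one then show ?case using one_in_reach by blast
next
  case (incl h) then show ?case using letter_in_reach by blast
next
  case (inv h) then show ?case using letter_in_reach by blast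
next
  case (eng h1 h2) then show ?case using reach_mult by blast
qed

lemma word_length_le_iff:
  assumes "generate G S = carrier G" "g \<in> carrier G"
  shows "word_length G S g \<le> n \<longleftrightarrow> g \<in> reach G S n"
proof -
  define Q where "Q n \<longleftrightarrow> (\<exists>w. length w = n \<and> set w \<subseteq> S \<union> m_inv G ` S \<and> foldr (\<otimes>) w \<one> = g)" for n
  have Q: "g \<in> reach G S n \<longleftrightarrow> (\<exists>m\<le>n. Q m)" for n
    unfolding Q_def reach_def by auto
  have wl: "word_length G S g = (LEAST n. Q n)"
    unfolding word_length_def Q_def ..
  have "\<exists>n. g \<in> reach G S n" using generate_reach assms by simp
  then obtain m where m: "Q m" using Q by blast
  then have "Q (LEAST n. Q n)" by (rule LeastI)
  moreover have "(LEAST n. Q n) \<le> m" if "Q m" for m using that by (rule Least_le)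
  ultimately show ?thesis
    unfolding wl Q using le_trans by blast
qed

lemma growth_function_reach:
  assumes "generate G S = carrier G"
  shows "growth_function G S n = card (reach G S n)"
proof -
  have "{g \<in> carrier G. word_length G S g \<le> n} = reach G S n"
    using word_length_le_iff[OF assms] reach_closed by blast
  then show ?thesis unfolding growth_function_def by simp
qed

end

lemma growth_rate_ge:
  assumes S: "S \<in> fin_gen_sets G" and z: "0 < z" "e > 0"
    and low: "\<And>n. real (card (reach G S n)) \<ge> e / z ^ n"
  shows "growth_rate G S \<ge> 1 / z"
proof -
  have S': "finite S" "S \<subseteq> carrier G" "generate G S = carrier G"
    using S unfolding fin_gen_sets_def by auto
  let ?F = "\<lambda>n. real (growth_function G S n)"
  have F: "?F n = real (card (reach G S n))" for n
    using growth_function_reach[OF S'(2,3)] by simp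
  have one: "?F n \<ge> 1" for n
  proof -
    have "card (reach G S n) > 0"
      using one_in_reach[OF S'(2)] finite_reach[OF S'(2,1)] by (auto simp: card_gt_0_iff)
    then show ?thesis unfolding F by simp
  qed
  have "?F (m + n) \<le> ?F m * ?F n" for m n
  proof -
    have "reach G S (m + n) \<subseteq> (\<lambda>(u, v). u \<otimes> v) ` (reach G S m \<times> reach G S n)"
      using reach_split[OF S'(2)] by fastforce
    then have "card (reach G S (m + n)) \<le> card ((\<lambda>(u, v). u \<otimes> v) ` (reach G S m \<times> reach G S n))"
      using finite_reach[OF S'(2,1)] by (intro card_mono) auto
    also have "\<dots> \<le> card (reach G S m \<times> reach G S n)"
      using finite_reach[OF S'(2,1)] by (intro card_image_le) auto
    finally have "card (reach G S (m + n)) \<le> card (reach G S m) * card (reach G S n)"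
      by (simp add: card_cartesian_product)
    then show ?thesis unfolding F by (simp flip: of_nat_mult)
  qed
  then have "convergent (\<lambda>n. root n (?F n))"
    using fekete_root_convergent[of ?F] one by blast
  then have lim: "(\<lambda>n. root n (?F n)) \<longlonglongrightarrow> growth_rate G S"
    unfolding growth_rate_def by (simp add: convergent_LIMSEQ_iff)
  have "(\<lambda>n. root n e * (1 / z)) \<longlonglongrightarrow> 1 * (1 / z)"
    using z by (intro tendsto_intros LIMSEQ_root_const)
  moreover have "eventually (\<lambda>n. root n e * (1 / z) \<le> root n (?F n)) sequentially"
    using eventually_gt_at_top[of 0]
  proof eventually_elim
    case (elim n)
    have "root n (e / z ^ n) \<le> root n (?F n)"
      using low[of n] elim unfolding F by simp
    moreover have "root n (e / z ^ n) = root n e * (1 / z)"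
      using elim z by (simp add: real_root_divide real_root_power_cancel)
    ultimately show ?case by simp
  qed
  ultimately have "1 * (1 / z) \<le> growth_rate G S"
    by (intro tendsto_le[OF sequentially_bot lim])
  then show ?thesis by simp
qed

text \<open>
  The translates \<open>g M\<close> and \<open>h M\<close> are disjoint.  If \<open>M\<close> is a monoid and the elements of a list
  are pairwise apart, then they generate a free submonoid.
\<close>

definition apart :: "'a set \<Rightarrow> 'a \<Rightarrow> 'a \<Rightarrow> bool" where
  "apart M g h \<longleftrightarrow> (\<forall>u\<in>M. \<forall>v\<in>M. g \<otimes> u \<noteq> h \<otimes> v)"

text \<open>
  The generating function of a list of elements \<open>c\<close> with assigned lengths \<open>l\<close>, at \<open>z\<close>.
\<close>
definition wt :: "real \<Rightarrow> ('a \<times> nat) list \<Rightarrow> real" where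
  "wt z C = (\<Sum>(c, l)\<leftarrow>C. z ^ l)"

lemma apart_sym: "apart M g h \<Longrightarrow> apart M h g"
  unfolding apart_def by metis

lemma code_card:
  assumes M: "M \<subseteq> carrier G" and fin: "\<And>n. finite (N n)" "\<And>n. N n \<subseteq> M"
    and C: "\<And>c l. (c, l) \<in> set C \<Longrightarrow> c \<in> carrier G"
    and ap: "sorted_wrt (\<lambda>a b. apart M (fst a) (fst b)) C"
    and sub: "\<And>c l. (c, l) \<in> set C \<Longrightarrow> (\<lambda>u. c \<otimes> u) ` N (n - l) \<subseteq> X"
    and X: "finite X"
  shows "(\<Sum>(c, l)\<leftarrow>C. card (N (n - l))) \<le> card X"
proof -
  have "(\<Sum>(c, l)\<leftarrow>C. card (N (n - l))) = card (\<Union>(c, l)\<in>set C. (\<lambda>u. c \<otimes> u) ` N (n - l))"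
    using C ap
  proof (induction C)
    case (Cons a C)
    obtain c l where a: "a = (c, l)" by (cases a)
    have c: "c \<in> carrier G" using Cons.prems(1) a by auto
    have IH: "(\<Sum>(c, l)\<leftarrow>C. card (N (n - l))) = card (\<Union>(c, l)\<in>set C. (\<lambda>u. c \<otimes> u) ` N (n - l))"
      using Cons.prems by (intro Cons.IH) auto
    have "card ((\<lambda>u. c \<otimes> u) ` N (n - l)) = card (N (n - l))"
    proof (intro card_image inj_on_inverseI)
      show "inv c \<otimes> (c \<otimes> u) = u" if "u \<in> N (n - l)" for u
        using that c fin(2) M by (intro inv_cancel_left) auto
    qed
    moreover have "(\<lambda>u. c \<otimes> u) ` N (n - l) \<inter> (\<Union>(c, l)\<in>set C. (\<lambda>u. c \<otimes> u) ` N (n - l)) = {}"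
    proof -
      have "c \<otimes> u \<noteq> d \<otimes> v" if "(d, k) \<in> set C" "u \<in> N (n - l)" "v \<in> N (n - k)" for d k u v
      proof -
        have "apart M c d" using Cons.prems(2) that(1) a by force
        then show ?thesis using that fin(2) unfolding apart_def by blast
      qed
      then show ?thesis by fastforce
    qed
    ultimately show ?case
      using IH a fin(1) by (auto simp: card_Un_disjoint split: prod.splits)
  qed simp
  also have "\<dots> \<le> card X" using sub X by (intro card_mono) auto
  finally show ?thesis .
qed

text \<open>
  The elements of \<open>g M g\<inverse>\<close> in the ball of radius \<open>n\<close> number at least \<open>z\<^bsup>K-n\<^esup>\<close>, where
  \<open>K\<close> is the largest length in the code.  This is shown by induction on \<open>n\<close>, as those in
  \<open>g c M g\<inverse>\<close> contain a copy of those counted in radius \<open>n - l\<close>.  The conjugation by \<open>g\<close>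
  moves the base vertex to the vertex where the generators diverge.
\<close>

lemma growth_rate_code:
  assumes S: "S \<in> fin_gen_sets G" and z: "0 < z" "z \<le> 1"
    and M: "M \<subseteq> carrier G" "\<one> \<in> M" and g: "g \<in> carrier G"
    and C: "\<And>c l. (c, l) \<in> set C \<Longrightarrow> c \<in> M \<and> l \<ge> 1 \<and> g \<otimes> c \<otimes> inv g \<in> reach G S l"
    and MM: "\<And>u v. u \<in> M \<Longrightarrow> v \<in> M \<Longrightarrow> u \<otimes> v \<in> M"
    and ap: "sorted_wrt (\<lambda>a b. apart M (fst a) (fst b)) C"
    and wt: "wt z C \<ge> 1"
  shows "growth_rate G S \<ge> 1 / z"
proof -
  have S': "finite S" "S \<subseteq> carrier G"
    using S unfolding fin_gen_sets_def by auto
  define N where "N n = {u \<in> M. g \<otimes> u \<otimes> inv g \<in> reach G S n}" for n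
  have inj: "inj_on (\<lambda>u. g \<otimes> u \<otimes> inv g) M"
  proof (rule inj_on_inverseI)
    show "inv g \<otimes> ((g \<otimes> u \<otimes> inv g) \<otimes> g) = u" if "u \<in> M" for u
      using that M g by (simp add: m_assoc subset_iff)
  qed
  have im: "(\<lambda>u. g \<otimes> u \<otimes> inv g) ` N n \<subseteq> reach G S n" for n
    unfolding N_def by auto
  have fin: "finite (N n)" for n
  proof (rule finite_imageD)
    show "finite ((\<lambda>u. g \<otimes> u \<otimes> inv g) ` N n)"
      using im finite_reach[OF S'(2,1)] by (rule finite_subset)
    show "inj_on (\<lambda>u. g \<otimes> u \<otimes> inv g) (N n)"
      using inj by (rule inj_on_subset) (auto simp: N_def)
  qed
  have card: "card (N n) \<le> card (reach G S n)" for n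
  proof (rule card_inj_on_le[OF _ im finite_reach[OF S'(2,1)]])
    show "inj_on (\<lambda>u. g \<otimes> u \<otimes> inv g) (N n)"
      using inj by (rule inj_on_subset) (auto simp: N_def)
  qed
  have one: "\<one> \<in> N n" for n
    unfolding N_def using M g one_in_reach[OF S'(2)] by simp
  define K where "K = Max (snd ` set C)"
  have K: "l \<le> K" if "(c, l) \<in> set C" for c l
    unfolding K_def using that by (intro Max_ge) force+
  have step: "(\<Sum>(c, l)\<leftarrow>C. card (N (n - l))) \<le> card (N n)" if n: "n \<ge> K" for n
  proof (rule code_card[OF M(1) fin _ _ ap _ fin])
    show "N n \<subseteq> M" for n unfolding N_def by auto
    show "c \<in> carrier G" if "(c, l) \<in> set C" for c l using that C M by blast
    fix c l assume cl: "(c, l) \<in> set C"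
    have "c \<otimes> u \<in> N n" if u: "u \<in> N (n - l)" for u
    proof -
      have "g \<otimes> c \<otimes> inv g \<otimes> (g \<otimes> u \<otimes> inv g) \<in> reach G S (l + (n - l))"
        using u C[OF cl] by (intro reach_mult[OF S'(2)]) (auto simp: N_def)
      moreover have "g \<otimes> c \<otimes> inv g \<otimes> (g \<otimes> u \<otimes> inv g) = g \<otimes> (c \<otimes> u) \<otimes> inv g"
        using g u C[OF cl] M by (simp add: N_def m_assoc subset_iff)
      moreover have "l + (n - l) = n" using K[OF cl] n by simp
      ultimately show ?thesis
        using u C[OF cl] MM by (simp add: N_def)
    qed
    then show "(\<lambda>u. c \<otimes> u) ` N (n - l) \<subseteq> N n" by blast
  qed
  have lower: "real (card (N n)) \<ge> z ^ K / z ^ n" for n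
  proof (induction n rule: less_induct)
    case (less n)
    show ?case
    proof (cases "n \<ge> K \<and> n \<ge> 1")
      case False
      have "card (N n) > 0" using one fin by (auto simp: card_gt_0_iff)
      moreover have le: "z ^ K \<le> z ^ n"
        using z False by (intro power_decreasing) auto
      moreover have "z ^ K / z ^ n \<le> 1" using z le by simp
      ultimately show ?thesis by linarith
    next
      case True
      have "z ^ K / z ^ n * 1 \<le> z ^ K / z ^ n * wt z C"
        using z wt by (intro mult_left_mono) auto
      also have "\<dots> = (\<Sum>(c, l)\<leftarrow>C. z ^ K / z ^ n * z ^ l)"
        unfolding wt_def sum_list_const_mult[symmetric] by (simp add: case_prod_unfold)
      also have "\<dots> \<le> (\<Sum>(c, l)\<leftarrow>C. real (card (N (n - l))))"
      proof (rule sum_list_mono, clarify)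
        fix c l assume cl: "(c, l) \<in> set C"
        have l: "l \<le> n" "l \<ge> 1" using K[OF cl] True C[OF cl] by auto
        have "z ^ K / z ^ n * z ^ l = z ^ K / z ^ (n - l)"
          using z l by (simp add: power_diff)
        also have "\<dots> \<le> real (card (N (n - l)))"
          using l by (intro less.IH) auto
        finally show "z ^ K / z ^ n * z ^ l \<le> real (card (N (n - l)))" .
      qed
      also have "\<dots> = real (\<Sum>(c, l)\<leftarrow>C. card (N (n - l)))"
        by (induction C) auto
      also have "\<dots> \<le> real (card (N n))" using step True by (simp only: of_nat_le_iff)
      finally show ?thesis by simp
    qed
  qed
  have "real (card (reach G S n)) \<ge> z ^ K / z ^ n" for n
    using lower[of n] card[of n] by (meson of_nat_le_iff order_trans)
  then show ?thesis
    using growth_rate_ge[OF S z(1), of "z ^ K"] z(1) by simp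
qed

end

section \<open>Ascending HNN extensions\<close>

text \<open>
  The group \<open>G\<close> with the image \<open>H\<close> of the base group, the stable letter \<open>t\<close> and the height
  \<open>ht\<close>.  The subgroup \<open>t H t\<inverse>\<close> is not a parameter: membership of \<open>b\<close> in it is
  expressed as \<open>t\<inverse> b t \<in> H\<close>.  Instead of its index, only two consequences of the quotient
  having order \<open>p\<close> are required, namely that it is nontrivial and killed by \<open>p\<close>.
\<close>
locale ascending_hnn = group G for G (structure) +
  fixes H :: "'a set" and t :: 'a and ht :: "'a \<Rightarrow> int" and p :: nat
  assumes subgroup_H: "subgroup H G"
    and t_closed [simp]: "t \<in> carrier G"
    and conj_t: "h \<in> H \<Longrightarrow> t \<otimes> h \<otimes> inv t \<in> H"
    and conj_t_normal: "h \<in> H \<Longrightarrow> k \<in> H \<Longrightarrow> inv t \<otimes> (inv k \<otimes> (t \<otimes> h \<otimes> inv t) \<otimes> k) \<otimes> t \<in> H"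
    and conj_t_proper: "\<exists>h\<in>H. inv t \<otimes> h \<otimes> t \<notin> H"
    and conj_t_pow: "h \<in> H \<Longrightarrow> inv t \<otimes> (h [^] p) \<otimes> t \<in> H"
    and prime_p: "prime p"
    and ht_mult [simp]: "g \<in> carrier G \<Longrightarrow> h \<in> carrier G \<Longrightarrow> ht (g \<otimes> h) = ht g + ht h"
    and ht_H: "h \<in> H \<Longrightarrow> ht h = 0"
    and ht_t [simp]: "ht t = 1"
    and decomp: "g \<in> carrier G \<Longrightarrow> \<exists>h\<in>H. \<exists>(i::nat) (j::nat). g = inv (t [^] i) \<otimes> h \<otimes> t [^] j"
begin

text \<open>
  Integral powers of \<open>t\<close>.
\<close>
definition T :: "int \<Rightarrow> 'a" where "T i = t [^] i"

text \<open>The subgroup \<open>t H t\<inverse>\<close>.\<close>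

definition B :: "'a set" where "B = {b \<in> H. inv t \<otimes> b \<otimes> t \<in> H}"

text \<open>
  The elements \<open>h t\<^sup>j\<close> with \<open>h \<in> H\<close> and \<open>j \<ge> 0\<close>, which send the base vertex to one of its
  descendants (or to itself).
\<close>
definition M :: "'a set" where "M = {g \<in> carrier G. 0 \<le> ht g \<and> g \<otimes> T (- ht g) \<in> H}"

text \<open>
  For \<open>g = h t\<^sup>j\<close> this is the coset \<open>h B\<close>.  If \<open>j > 0\<close> it stands for the child of the base vertex
  below which (or at which) \<open>g\<close> sends the base vertex.
\<close>
definition D :: "'a \<Rightarrow> 'a set" where "D g = {y \<in> carrier G. inv (g \<otimes> T (- ht g)) \<otimes> y \<in> B}"

interpretation H: subgroup H G by (rule subgroup_H)

lemma H_closed [simp]: "h \<in> H \<Longrightarrow> h \<in> carrier G"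
  by (rule H.mem_carrier)

lemma T_closed [simp]: "T i \<in> carrier G"
  by (simp add: T_def)

lemma T_0 [simp]: "T 0 = \<one>"
  by (simp add: T_def)

lemma T_mult [simp]: "T i \<otimes> T j = T (i + j)"
  by (simp add: T_def int_pow_mult)

lemma T_mult_left [simp]: "z \<in> carrier G \<Longrightarrow> T i \<otimes> (T j \<otimes> z) = T (i + j) \<otimes> z"
  by (simp flip: m_assoc)

lemma inv_T [simp]: "inv (T i) = T (- i)"
  by (simp add: T_def int_pow_neg)

lemma T_1: "T 1 = t" "T (-1) = inv t"
  by (simp_all add: T_def int_pow_neg)

lemma conj_T_1: "h \<in> H \<Longrightarrow> T 1 \<otimes> h \<otimes> T (-1) \<in> H"
  by (simp add: T_1 conj_t)

lemma ht_one [simp]: "ht \<one> = 0"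
  using ht_H H.one_closed by blast

lemma ht_inv [simp]: "g \<in> carrier G \<Longrightarrow> ht (inv g) = - ht g"
  using ht_mult[of g "inv g"] by simp

lemma ht_pow [simp]: "g \<in> carrier G \<Longrightarrow> ht (g [^] (n::nat)) = int n * ht g"
  by (induction n) (auto simp: algebra_simps)

lemma ht_T [simp]: "ht (T i) = i"
  by (cases i rule: int_cases2) (simp_all add: T_def int_pow_neg int_pow_int)

lemma conj_T:
  assumes "h \<in> H" "i \<ge> 0" shows "T i \<otimes> h \<otimes> T (- i) \<in> H"
proof -
  have "T (int n) \<otimes> h \<otimes> T (- int n) \<in> H" for n
  proof (induction n)
    case (Suc n)
    have "T 1 \<otimes> (T (int n) \<otimes> h \<otimes> T (- int n)) \<otimes> T (-1) \<in> H"
      using Suc by (rule conj_T_1)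
    then show ?case
      using assms by (simp add: m_assoc add.commute)
  qed (use assms in simp)
  then show ?thesis using assms(2) by (metis nonneg_int_cases)
qed

lemma B_subset_H: "b \<in> B \<Longrightarrow> b \<in> H"
  unfolding B_def by simp

lemma B_iff: "b \<in> H \<Longrightarrow> b \<in> B \<longleftrightarrow> T (-1) \<otimes> b \<otimes> T 1 \<in> H"
  by (simp add: B_def T_1)

lemma B_I: "b \<in> H \<Longrightarrow> T (-1) \<otimes> b \<otimes> T 1 \<in> H \<Longrightarrow> b \<in> B"
  by (simp add: B_iff)

lemma B_D: "b \<in> B \<Longrightarrow> T (-1) \<otimes> b \<otimes> T 1 \<in> H"
  using B_iff B_subset_H by blast

lemma B_one: "\<one> \<in> B"
  by (intro B_I) auto

lemma B_mult:
  assumes "b \<in> B" "c \<in> B" shows "b \<otimes> c \<in> B"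
proof (rule B_I)
  note [simp] = assms[THEN B_subset_H]
  show "b \<otimes> c \<in> H" by simp
  have "(T (-1) \<otimes> b \<otimes> T 1) \<otimes> (T (-1) \<otimes> c \<otimes> T 1) \<in> H"
    using assms by (intro H.m_closed B_D)
  then show "T (-1) \<otimes> (b \<otimes> c) \<otimes> T 1 \<in> H"
    by (simp add: m_assoc)
qed

lemma B_inv:
  assumes "b \<in> B" shows "inv b \<in> B"
proof (rule B_I)
  note [simp] = assms[THEN B_subset_H]
  show "inv b \<in> H" by simp
  have "inv (T (-1) \<otimes> b \<otimes> T 1) \<in> H"
    using assms by (intro H.m_inv_closed B_D)
  then show "T (-1) \<otimes> inv b \<otimes> T 1 \<in> H"
    by (simp add: inv_mult_group m_assoc)
qed

lemma B_conj:
  assumes "b \<in> B" "k \<in> H" shows "inv k \<otimes> b \<otimes> k \<in> B"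
proof (rule B_I)
  note [simp] = assms(1)[THEN B_subset_H] assms(2)
  show "inv k \<otimes> b \<otimes> k \<in> H" by simp
  have "T (-1) \<otimes> (inv k \<otimes> (T 1 \<otimes> (T (-1) \<otimes> b \<otimes> T 1) \<otimes> T (-1)) \<otimes> k) \<otimes> T 1 \<in> H"
    using conj_t_normal[OF B_D[OF assms(1)] assms(2)] by (simp only: T_1)
  then show "T (-1) \<otimes> (inv k \<otimes> b \<otimes> k) \<otimes> T 1 \<in> H"
    by (simp add: m_assoc)
qed

lemma conj_T_B:
  assumes "h \<in> H" "i > 0" shows "T i \<otimes> h \<otimes> T (- i) \<in> B"
proof (rule B_I)
  show "T i \<otimes> h \<otimes> T (- i) \<in> H" using assms by (intro conj_T) auto
  have "T (i - 1) \<otimes> h \<otimes> T (- (i - 1)) \<in> H" using assms by (intro conj_T) auto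
  then show "T (-1) \<otimes> (T i \<otimes> h \<otimes> T (- i)) \<otimes> T 1 \<in> H"
    using assms by (simp add: m_assoc)
qed

lemma B_nat_pow: "b \<in> B \<Longrightarrow> b [^] (n::nat) \<in> B"
  by (induction n) (auto simp: B_one B_mult)

lemma B_int_pow: "b \<in> B \<Longrightarrow> b [^] (n::int) \<in> B"
  by (cases n rule: int_cases2)
    (auto simp: int_pow_int int_pow_neg B_subset_H B_nat_pow intro!: B_inv)

text \<open>
  Every element of \<open>H - B\<close> has order \<open>p\<close> modulo \<open>B\<close>.
\<close>
lemma pow_in_B_dvd:
  assumes k: "k \<in> H" "k \<notin> B" and i: "k [^] (i::int) \<in> B"
  shows "int p dvd i"
proof (rule ccontr)
  assume "\<not> int p dvd i"
  then have "coprime (int p) i"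
    using prime_p by (intro prime_imp_coprime) auto
  then have "gcd (int p) i = 1" by simp
  then obtain a b where ab: "a * int p + b * i = 1"
    using bezout_int[of "int p" i] by metis
  have "k [^] p \<in> B"
    using conj_t_pow[OF k(1)] subgroup_int_pow_closed[OF subgroup_H k(1), of "int p"] by (simp add: B_def int_pow_int)
  then have "(k [^] int p) [^] a \<otimes> (k [^] i) [^] b \<in> B"
    using i by (intro B_mult B_int_pow[of "k [^] int p"] B_int_pow[of "k [^] i"]) (simp_all add: int_pow_int)
  also have "(k [^] int p) [^] a \<otimes> (k [^] i) [^] b = k [^] (1::int)"
    using k(1) ab by (simp add: int_pow_pow int_pow_mult[symmetric] mult.commute)
  finally show False using k by simp
qed

lemma M_closed [simp]: "g \<in> M \<Longrightarrow> g \<in> carrier G"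
  unfolding M_def by simp

lemma M_ht: "g \<in> M \<Longrightarrow> ht g \<ge> 0"
  unfolding M_def by simp

lemma M_intro: "h \<in> H \<Longrightarrow> i \<ge> 0 \<Longrightarrow> h \<otimes> T i \<in> M"
  unfolding M_def by (simp add: ht_H m_assoc)

lemma M_decomp: "g \<in> M \<Longrightarrow> \<exists>h\<in>H. g = h \<otimes> T (ht g)"
proof -
  assume g: "g \<in> M"
  then have "g = (g \<otimes> T (- ht g)) \<otimes> T (ht g)" by (simp add: m_assoc)
  then show ?thesis using g unfolding M_def by blast
qed

lemma M_ht_0: "g \<in> M \<Longrightarrow> ht g = 0 \<Longrightarrow> g \<in> H"
  unfolding M_def by auto

lemma H_subset_M: "h \<in> H \<Longrightarrow> h \<in> M"
  unfolding M_def by (simp add: ht_H)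

lemma M_one: "\<one> \<in> M"
  by (simp add: H_subset_M)

lemma M_T: "i \<ge> 0 \<Longrightarrow> T i \<in> M"
  using M_intro[of \<one> i] by simp

text \<open>
  In the tree, ancestors of a vertex are linearly ordered: the quotient \<open>u v\<inverse>\<close> of two
  elements of \<open>M\<close> again lies in \<open>M\<close> as soon as its height allows it.
\<close>

lemma M_quotient:
  assumes "u \<in> M" "v \<in> M" "ht v \<le> ht u"
  shows "u \<otimes> inv v \<in> M"
proof -
  obtain h k where h: "h \<in> H" "u = h \<otimes> T (ht u)" and k: "k \<in> H" "v = k \<otimes> T (ht v)"
    using M_decomp assms by meson
  let ?d = "ht u - ht v"
  have "h \<otimes> (T ?d \<otimes> inv k \<otimes> T (- ?d)) \<in> H"
    using h k assms by (intro H.m_closed conj_T) auto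
  then have "h \<otimes> (T ?d \<otimes> inv k \<otimes> T (- ?d)) \<otimes> T ?d \<in> M"
    using assms by (intro M_intro) auto
  also have "h \<otimes> (T ?d \<otimes> inv k \<otimes> T (- ?d)) \<otimes> T ?d = h \<otimes> T (ht u) \<otimes> inv (k \<otimes> T (ht v))"
    using h(1) k(1) by (simp add: m_assoc inv_mult_group)
  finally show ?thesis using h(2) k(2) by metis
qed

lemma M_mult: "u \<in> M \<Longrightarrow> v \<in> M \<Longrightarrow> u \<otimes> v \<in> M"
proof -
  assume u: "u \<in> M" and v: "v \<in> M"
  obtain k where k: "k \<in> H" "v = k \<otimes> T (ht v)" using M_decomp v by meson
  have "u \<otimes> inv (inv k) \<in> M"
    using u k M_ht by (intro M_quotient) (auto simp: H_subset_M ht_H)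
  then obtain h where h: "h \<in> H" "u \<otimes> k = h \<otimes> T (ht u)"
    using M_decomp[of "u \<otimes> k"] u k by (auto simp: ht_H)
  have "u \<otimes> v = u \<otimes> k \<otimes> T (ht v)"
    using u k by (simp add: m_assoc flip: k(2))
  also have "\<dots> = h \<otimes> T (ht u + ht v)"
    using h(1) by (simp add: h(2) m_assoc)
  also have "\<dots> \<in> M" using h u v M_ht by (intro M_intro) auto
  finally show ?thesis .
qed

lemma M_pow: "u \<in> M \<Longrightarrow> u [^] (n::nat) \<in> M"
  by (induction n) (auto simp: M_one M_mult)

lemma M_conj_H: "u \<in> M \<Longrightarrow> h \<in> H \<Longrightarrow> inv h \<otimes> u \<otimes> h \<in> M"
  by (intro M_mult) (auto simp: H_subset_M)

lemma M_conj_T: "u \<in> M \<Longrightarrow> T 1 \<otimes> u \<otimes> T (-1) \<in> M"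
  using M_quotient[of "T 1 \<otimes> u" "T 1"] M_ht by (simp add: M_T M_mult)

lemma D_eq_iff:
  assumes "g \<in> M" "g' \<in> M"
  shows "D g = D g' \<longleftrightarrow> inv (g \<otimes> T (- ht g)) \<otimes> (g' \<otimes> T (- ht g')) \<in> B"
proof -
  define h h' where "h = g \<otimes> T (- ht g)" and "h' = g' \<otimes> T (- ht g')"
  have h: "h \<in> H" "h' \<in> H" using assms unfolding h_def h'_def M_def by auto
  have D: "D g = {y \<in> carrier G. inv h \<otimes> y \<in> B}" "D g' = {y \<in> carrier G. inv h' \<otimes> y \<in> B}"
    unfolding D_def h_def h'_def by auto
  show ?thesis
  proof
    assume "D g = D g'"
    moreover have "h' \<in> D g'" using h by (simp add: D B_one)
    ultimately have "h' \<in> D g" by simp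
    then show "inv (g \<otimes> T (- ht g)) \<otimes> (g' \<otimes> T (- ht g')) \<in> B"
      by (simp add: D flip: h_def h'_def)
  next
    assume "inv (g \<otimes> T (- ht g)) \<otimes> (g' \<otimes> T (- ht g')) \<in> B"
    then have *: "inv h \<otimes> h' \<in> B" by (simp flip: h_def h'_def)
    have "inv h \<otimes> y \<in> B \<longleftrightarrow> inv h' \<otimes> y \<in> B" if y: "y \<in> carrier G" for y
    proof
      assume "inv h \<otimes> y \<in> B"
      then have "inv (inv h \<otimes> h') \<otimes> (inv h \<otimes> y) \<in> B" using B_mult[OF B_inv[OF *]] by blast
      then show "inv h' \<otimes> y \<in> B" using h y by (simp add: inv_mult_group m_assoc)
    next
      assume "inv h' \<otimes> y \<in> B"
      then have "(inv h \<otimes> h') \<otimes> (inv h' \<otimes> y) \<in> B" using B_mult[OF *] by blast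
      then show "inv h \<otimes> y \<in> B" using h y by (simp add: m_assoc)
    qed
    then show "D g = D g'" unfolding D by blast
  qed
qed

text \<open>
  The child does not change when one descends further.
\<close>
lemma D_mult:
  assumes g: "g \<in> M" "ht g > 0" and u: "u \<in> M"
  shows "D (g \<otimes> u) = D g"
proof -
  obtain h k where h: "h \<in> H" "g = h \<otimes> T (ht g)" and k: "k \<in> H" "u = k \<otimes> T (ht u)"
    using M_decomp g u by meson
  define a b where "a = ht g" and "b = ht u"
  have eq: "g = h \<otimes> T a" "u = k \<otimes> T b" using h k unfolding a_def b_def by auto
  have "T a \<otimes> k \<otimes> T (- a) \<in> B"
    using g k unfolding a_def by (intro conj_T_B) auto
  moreover have "inv (g \<otimes> T (- ht g)) \<otimes> (g \<otimes> u \<otimes> T (- ht (g \<otimes> u))) = T a \<otimes> k \<otimes> T (- a)"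
    unfolding eq using h(1) k(1) by (simp add: ht_H m_assoc)
  ultimately have "D g = D (g \<otimes> u)"
    using g u by (subst D_eq_iff) (auto simp: M_mult)
  then show ?thesis ..
qed

lemma D_H_cong:
  assumes "k \<in> H" "g \<in> M" "g' \<in> M" "D g = D g'"
  shows "D (k \<otimes> g) = D (k \<otimes> g')"
proof -
  have *: "inv (k \<otimes> g \<otimes> T (- ht g)) \<otimes> (k \<otimes> g' \<otimes> T (- ht g')) =
      inv (g \<otimes> T (- ht g)) \<otimes> (g' \<otimes> T (- ht g'))"
    using assms by (simp add: inv_mult_group m_assoc)
  show ?thesis
    using assms * by (simp add: D_eq_iff M_mult H_subset_M ht_H)
qed

text \<open>The elements of \<open>H - B\<close> permute the children of the base vertex freely modulo \<open>p\<close>.\<close>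

lemma D_pow_eq:
  assumes k: "k \<in> H" "k \<notin> B" and g: "g \<in> M"
    and eq: "D (k [^] (i::int) \<otimes> g) = D (k [^] (j::int) \<otimes> g)"
  shows "int p dvd j - i"
proof -
  define h where "h = g \<otimes> T (- ht g)"
  have h: "h \<in> H" using g unfolding h_def M_def by auto
  have ki: "k [^] i \<in> H" for i :: int
    using k(1) subgroup_H by (simp add: subgroup_int_pow_closed)
  have "inv (k [^] i \<otimes> g \<otimes> T (- ht (k [^] i \<otimes> g))) \<otimes> (k [^] j \<otimes> g \<otimes> T (- ht (k [^] j \<otimes> g))) \<in> B"
    using eq g ki by (subst (asm) D_eq_iff) (auto intro: M_mult H_subset_M)
  then have "inv (k [^] i \<otimes> h) \<otimes> (k [^] j \<otimes> h) \<in> B"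
    using g ki k by (simp add: ht_H h_def m_assoc)
  moreover have "k [^] j = k [^] i \<otimes> k [^] (j - i)"
    using k by (simp flip: int_pow_mult)
  ultimately have "inv h \<otimes> k [^] (j - i) \<otimes> h \<in> B"
    using h k by (simp add: inv_mult_group m_assoc)
  then have "inv (inv h) \<otimes> (inv h \<otimes> k [^] (j - i) \<otimes> h) \<otimes> inv h \<in> B"
    using h by (intro B_conj[OF _ H.m_inv_closed])
  then have "k [^] (j - i) \<in> B" using h k by (simp add: m_assoc)
  then show ?thesis using k pow_in_B_dvd by blast
qed

lemma apart_D:
  assumes "g \<in> M" "g' \<in> M" "ht g > 0" "ht g' > 0" "D g \<noteq> D g'"
  shows "apart M g g'"
  unfolding apart_def using assms D_mult by metis

lemma apart_cancel:
  assumes "c \<in> carrier G" "g \<in> carrier G" "g' \<in> carrier G" "apart M g g'"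
  shows "apart M (c \<otimes> g) (c \<otimes> g')"
proof -
  have "c \<otimes> g \<otimes> u \<noteq> c \<otimes> g' \<otimes> v" if "u \<in> M" "v \<in> M" for u v
    using that assms by (simp add: m_assoc) (auto simp: apart_def)
  then show ?thesis unfolding apart_def by blast
qed

lemma M_conj_T_nonneg:
  assumes "u \<in> M" "i \<ge> 0" shows "T i \<otimes> u \<otimes> T (- i) \<in> M"
  using M_quotient[of "T i \<otimes> u" "T i"] assms M_ht[of u] by (simp add: M_T M_mult)

section \<open>Where the generators diverge\<close>

lemma conj_T_add:
  assumes "u \<in> carrier G"
  shows "T i \<otimes> (T j \<otimes> u \<otimes> T (- j)) \<otimes> T (- i) = T (i + j) \<otimes> u \<otimes> T (- (i + j))"
  using assms by (simp add: m_assoc minus_diff_commute[of j i])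

text \<open>
  High enough up, the axes of finitely many elements share their vertices, because all of them
  lead to the fixed end.
\<close>
lemma eventually_in_M:
  assumes "finite X" "\<And>u. u \<in> X \<Longrightarrow> u \<in> carrier G \<and> ht u \<ge> 0"
  shows "\<exists>i\<ge>0. \<forall>u\<in>X. T i \<otimes> u \<otimes> T (- i) \<in> M"
  using assms
proof (induction X rule: finite_induct)
  case empty
  then show ?case by auto
next
  case (insert u X)
  then obtain i where i: "i \<ge> 0" "\<And>v. v \<in> X \<Longrightarrow> T i \<otimes> v \<otimes> T (- i) \<in> M" by auto
  have u: "u \<in> carrier G" "ht u \<ge> 0" using insert.prems by auto
  from decomp[OF u(1)] obtain h and a b :: nat
    where h: "h \<in> H" "u = inv (t [^] a) \<otimes> h \<otimes> t [^] b" by blast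
  have pow: "t [^] a = T (int a)" for a :: nat by (simp add: T_def int_pow_int)
  have hu: "ht u = int b - int a" using h by (simp add: ht_H)
  have "T (int a) \<otimes> u \<otimes> T (- int a) = h \<otimes> T (int b - int a)"
    using h(1) unfolding h(2) pow by (simp add: m_assoc)
  then have ua: "T (int a) \<otimes> u \<otimes> T (- int a) \<in> M"
    using h hu u(2) M_intro[of h "int b - int a"] by simp
  have "T (i + int a) \<otimes> u \<otimes> T (- (i + int a)) \<in> M"
    using M_conj_T_nonneg[OF ua i(1)] u by (simp only: conj_T_add)
  moreover have "T (i + int a) \<otimes> v \<otimes> T (- (i + int a)) \<in> M" if "v \<in> X" for v
  proof -
    have "T (int a) \<otimes> (T i \<otimes> v \<otimes> T (- i)) \<otimes> T (- int a) \<in> M"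
      using i(2)[OF that] by (rule M_conj_T_nonneg) simp
    then show ?thesis
      using insert.prems(1)[of v] that by (simp only: conj_T_add insert_iff simp_thms add.commute[of i])
  qed
  ultimately show ?case using i(1) by (intro exI[of _ "i + int a"]) auto
qed

text \<open>
  The axis of an element \<open>m\<close> of positive height has only one vertex of each height: if the base
  vertex and its image under \<open>a\<close> both lie on the axis of \<open>m\<close>, at the same height, then they
  agree.
\<close>

lemma axis_unique:
  assumes m: "m \<in> M" "ht m > 0" and a: "a \<in> carrier G" "ht a = 0" "inv a \<otimes> m \<otimes> a \<in> M"
  shows "a \<in> H"
proof -
  from decomp[OF a(1)] obtain h and i j :: nat
    where h: "h \<in> H" "a = inv (t [^] i) \<otimes> h \<otimes> t [^] j" by blast
  have ij: "int i = int j" using a(2) h by (simp add: ht_H)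
  have pow: "t [^] a = T (int a)" for a :: nat by (simp add: T_def int_pow_int)
  have a_eq: "a = T (- int i) \<otimes> h \<otimes> T (int i)" using h(2) ij unfolding pow by simp
  define w where "w = m [^] i"
  have w: "w \<in> M" "ht w \<ge> int i"
    unfolding w_def using m by (auto simp: M_pow mult_le_cancel_left1)
  have conj: "inv a \<otimes> w \<otimes> a \<in> M"
  proof -
    have "(inv a \<otimes> m \<otimes> a) [^] i = inv a \<otimes> w \<otimes> a"
      unfolding w_def
    proof (induction i)
      case (Suc i)
      then show ?case using a(1) m by (simp add: m_assoc)
    qed (use a(1) in simp)
    then show ?thesis using M_pow[OF a(3), of i] by simp
  qed
  have "w \<otimes> inv (T (int i)) \<in> M"
    using w by (intro M_quotient) (auto simp: M_T)
  then have "(w \<otimes> inv (T (int i))) \<otimes> (h \<otimes> T (int i)) \<in> M"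
    using h by (intro M_mult[OF _ M_intro]) auto
  also have "(w \<otimes> inv (T (int i))) \<otimes> (h \<otimes> T (int i)) = w \<otimes> a"
    using w h(1) unfolding a_eq by (simp add: m_assoc)
  finally have wa: "w \<otimes> a \<in> M" .
  have "(w \<otimes> a) \<otimes> inv (inv a \<otimes> w \<otimes> a) \<in> M"
    using wa conj w a by (intro M_quotient) auto
  also have "(w \<otimes> a) \<otimes> inv (inv a \<otimes> w \<otimes> a) = a"
    using w(1) a(1) by (simp add: inv_mult_group m_assoc)
  finally show ?thesis using a(2) by (rule M_ht_0)
qed

text \<open>
  The generators and their inverses, of nonnegative height.
\<close>
definition pos :: "'a set \<Rightarrow> 'a set" where
  "pos S = {s \<in> S \<union> m_inv G ` S. ht s \<ge> 0}"

text \<open>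
  The set of \<open>g\<close> such that every element of \<open>pos S\<close> moves the vertex \<open>g H\<close> weakly down, that is,
  \<open>g H\<close> is fixed by the elliptic and lies on the axis of the hyperbolic elements of \<open>pos S\<close>.
\<close>

definition common :: "'a set \<Rightarrow> 'a set" where
  "common S = {g \<in> carrier G. \<forall>s\<in>pos S. inv g \<otimes> s \<otimes> g \<in> M}"

text \<open>
  If the generators diverged nowhere, then the common vertices would form a line that is invariant
  under all generators, hence under \<open>G\<close>.  But \<open>t\<close> and \<open>h t\<close> with \<open>h \<in> H - B\<close> send the base vertex to
  different vertices of the same height.
\<close>
lemma diverge:
  assumes S: "S \<in> fin_gen_sets G"
  shows "\<exists>g\<in>common S. \<exists>x\<in>pos S. ht x > 0 \<and>
    ((\<exists>a\<in>pos S. inv g \<otimes> a \<otimes> g \<in> H - B) \<or>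
     (\<exists>y\<in>pos S. ht y > 0 \<and> D (inv g \<otimes> y \<otimes> g) \<noteq> D (inv g \<otimes> x \<otimes> g)))"
proof (rule ccontr)
  assume contra: "\<not> ?thesis"
  have S': "finite S" "S \<subseteq> carrier G" "generate G S = carrier G"
    using S unfolding fin_gen_sets_def by auto
  have pos_closed [simp]: "s \<in> carrier G" "ht s \<ge> 0" if "s \<in> pos S" for s
    using that S' unfolding pos_def by auto
  have common_closed [simp]: "g \<in> carrier G" if "g \<in> common S" for g
    using that unfolding common_def by simp
  have commonD: "inv g \<otimes> s \<otimes> g \<in> M" if "g \<in> common S" "s \<in> pos S" for g s
    using that unfolding common_def by simp
  have commonI: "g \<in> common S"
    if "g \<in> carrier G" "\<And>s. s \<in> pos S \<Longrightarrow> inv g \<otimes> s \<otimes> g \<in> M" for g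
    using that unfolding common_def by simp
  obtain x where x: "x \<in> pos S" "ht x > 0"
  proof -
    have "\<exists>s\<in>S. ht s \<noteq> 0"
    proof (rule ccontr)
      assume "\<not> ?thesis"
      then have zero: "ht s = 0" if "s \<in> S" for s using that by blast
      have "g \<in> carrier G \<and> ht g = 0" if "g \<in> generate G S" for g
        using that
      proof (induction rule: generate.induct)
        case (incl h)
        then show ?case using S' zero by auto
      next
        case (inv h)
        then show ?case using S' zero by auto
      qed auto
      then have "ht t = 0" using S'(3) t_closed by blast
      then show False by simp
    qed
    then obtain s where s: "s \<in> S" "ht s \<noteq> 0" by blast
    have s_closed: "s \<in> carrier G" using s(1) S'(2) by blast
    show thesis
    proof (cases "ht s > 0")
      case True
      then have "s \<in> pos S" using s(1) unfolding pos_def by simp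
      then show ?thesis using True by (rule that)
    next
      case False
      then have "ht (inv s) > 0" using s(2) s_closed by simp
      moreover have "inv s \<in> pos S" using calculation s(1) unfolding pos_def by simp
      ultimately show ?thesis by (intro that)
    qed
  qed
  have common_H: "g \<otimes> h \<in> common S" if g: "g \<in> common S" and h: "h \<in> H" for g h
  proof (rule commonI)
    show "g \<otimes> h \<in> carrier G" using g h by simp
    fix s assume s: "s \<in> pos S"
    have "inv (g \<otimes> h) \<otimes> s \<otimes> (g \<otimes> h) = inv h \<otimes> (inv g \<otimes> s \<otimes> g) \<otimes> h"
      using s g h by (simp add: inv_mult_group m_assoc)
    then show "inv (g \<otimes> h) \<otimes> s \<otimes> (g \<otimes> h) \<in> M"
      using M_conj_H[OF commonD[OF g s] h] by simp
  qed
  have up: "g \<otimes> T (-1) \<in> common S" if g: "g \<in> common S" for g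
  proof (rule commonI)
    show "g \<otimes> T (-1) \<in> carrier G" using g by simp
    fix s assume s: "s \<in> pos S"
    have "inv (g \<otimes> T (-1)) \<otimes> s \<otimes> (g \<otimes> T (-1)) = T 1 \<otimes> (inv g \<otimes> s \<otimes> g) \<otimes> T (-1)"
      using s g by (simp add: inv_mult_group m_assoc)
    then show "inv (g \<otimes> T (-1)) \<otimes> s \<otimes> (g \<otimes> T (-1)) \<in> M"
      using M_conj_T[OF commonD[OF g s]] by simp
  qed
  \<comment> \<open>As nothing diverges at \<open>g H\<close>, the next vertex on the axis of \<open>x\<close> is again common.\<close>
  have down: "\<exists>g'\<in>common S. ht g' = ht g + 1" if g: "g \<in> common S" for g
  proof -
    let ?x = "inv g \<otimes> x \<otimes> g"
    have xM: "?x \<in> M" using commonD g x by blast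
    have hx: "ht ?x = ht x" using g x by simp
    obtain h where h: "h \<in> H" "?x = h \<otimes> T (ht x)" using M_decomp[OF xM] unfolding hx by blast
    have "inv (g \<otimes> (h \<otimes> T 1)) \<otimes> s \<otimes> (g \<otimes> (h \<otimes> T 1)) \<in> M" if s: "s \<in> pos S" for s
    proof -
      let ?s = "inv g \<otimes> s \<otimes> g"
      have sM: "?s \<in> M" using commonD g s by blast
      have hs: "ht ?s = ht s" using g s by simp
      have eq: "inv (g \<otimes> (h \<otimes> T 1)) \<otimes> s \<otimes> (g \<otimes> (h \<otimes> T 1)) = T (-1) \<otimes> (inv h \<otimes> ?s \<otimes> h) \<otimes> T 1"
        using g s h(1) by (simp add: inv_mult_group m_assoc)
      show ?thesis
      proof (cases "ht s = 0")
        case True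
        then have "?s \<in> H" using sM hs by (intro M_ht_0) auto
        then have "?s \<in> B" using contra g x s by blast
        then have "inv h \<otimes> ?s \<otimes> h \<in> B" using h(1) by (rule B_conj)
        then show ?thesis unfolding eq by (rule H_subset_M[OF B_D])
      next
        case False
        then have hs0: "ht s > 0" using pos_closed(2)[OF s] by simp
        then have "D ?x = D ?s" using contra g x s by metis
        then have "inv (?x \<otimes> T (- ht x)) \<otimes> (?s \<otimes> T (- ht s)) \<in> B"
          using xM sM by (subst (asm) D_eq_iff) (simp_all only: hx hs)
        moreover have "?x \<otimes> T (- ht x) = h" unfolding h(2) using h(1) by (simp add: m_assoc)
        ultimately have b: "inv h \<otimes> (?s \<otimes> T (- ht s)) \<in> B" by simp
        define b where "b = inv h \<otimes> (?s \<otimes> T (- ht s))"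
        have bB: "b \<in> B" using b unfolding b_def .
        have s_eq: "inv h \<otimes> ?s = b \<otimes> T (ht s)"
          unfolding b_def using g s h(1) by (simp add: m_assoc)
        have "(T (-1) \<otimes> b \<otimes> T 1) \<otimes> T (ht s - 1) \<otimes> (h \<otimes> T 1) \<in> M"
          using hs0 by (intro M_mult[OF M_intro[OF B_D[OF bB]] M_intro[OF h(1)]]) auto
        also have "(T (-1) \<otimes> b \<otimes> T 1) \<otimes> T (ht s - 1) \<otimes> (h \<otimes> T 1) =
            T (-1) \<otimes> (b \<otimes> T (ht s) \<otimes> h) \<otimes> T 1"
          using h(1) B_subset_H[OF bB] by (simp add: m_assoc)
        finally show ?thesis unfolding eq s_eq .
      qed
    qed
    then have "g \<otimes> (h \<otimes> T 1) \<in> common S"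
      using g h(1) by (intro commonI) simp_all
    moreover have "ht (g \<otimes> (h \<otimes> T 1)) = ht g + 1" using g h(1) by (simp add: ht_H)
    ultimately show ?thesis by blast
  qed
  have level: "\<exists>g'\<in>common S. ht g' = ht g + i" if g: "g \<in> common S" for g i
  proof (induction i rule: int_induct[of _ 0])
    case base
    then show ?case using g by auto
  next
    case (step1 i)
    then obtain g' where g': "g' \<in> common S" "ht g' = ht g + i" by blast
    from down[OF g'(1)] g'(2) show ?case by (metis add.assoc)
  next
    case (step2 i)
    then obtain g' where g': "g' \<in> common S" "ht g' = ht g + i" by blast
    then show ?case using up[OF g'(1)] by (intro bexI[of _ "g' \<otimes> T (-1)"]) simp_all
  qed
  \<comment> \<open>So there is exactly one common vertex of each height.\<close>
  have unique: "inv g \<otimes> g' \<in> H" if g: "g \<in> common S" "g' \<in> common S" "ht g = ht g'" for g g'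
  proof (rule axis_unique)
    show "inv g \<otimes> x \<otimes> g \<in> M" using commonD g x by blast
    show "ht (inv g \<otimes> x \<otimes> g) > 0" using g x by simp
    have "inv (inv g \<otimes> g') \<otimes> (inv g \<otimes> x \<otimes> g) \<otimes> (inv g \<otimes> g') = inv g' \<otimes> x \<otimes> g'"
      using g x by (simp add: inv_mult_group m_assoc)
    then show "inv (inv g \<otimes> g') \<otimes> (inv g \<otimes> x \<otimes> g) \<otimes> (inv g \<otimes> g') \<in> M"
      using commonD g x by simp
  qed (use g in auto)
  have down_M: "inv g \<otimes> g' \<in> M"
    if g: "g \<in> common S" "g' \<in> common S" "ht g \<le> ht g'" for g g'
  proof -
    have Tn: "g' \<otimes> T (- int n) \<in> common S" for n
    proof (induction n)
      case (Suc n)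
      from up[OF this] show ?case using g by (simp add: m_assoc minus_diff_commute[of "int n"])
    qed (use g in simp)
    obtain n where n: "ht g' - ht g = int n" using g(3) by (metis diff_ge_0_iff_ge nonneg_int_cases)
    have "inv g \<otimes> (g' \<otimes> T (- int n)) \<in> H"
      using g Tn n by (intro unique) auto
    then have "inv g \<otimes> (g' \<otimes> T (- int n)) \<otimes> T (int n) \<in> M" by (intro M_intro) auto
    then show ?thesis using g by (simp add: m_assoc)
  qed
  \<comment> \<open>Each generator sends a common vertex to the common vertex of the appropriate height.\<close>
  have fwd: "s \<otimes> g \<in> common S" if g: "g \<in> common S" and s: "s \<in> pos S" for g s
  proof -
    obtain g' where g': "g' \<in> common S" "ht g' = ht g + ht s" using level[OF g] by blast
    have "(inv g' \<otimes> s \<otimes> g') \<otimes> inv (inv g \<otimes> g') \<in> M"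
      using g g' s by (intro M_quotient[OF commonD down_M]) auto
    moreover have "(inv g' \<otimes> s \<otimes> g') \<otimes> inv (inv g \<otimes> g') = inv g' \<otimes> (s \<otimes> g)"
      using g g' s by (simp add: inv_mult_group m_assoc)
    ultimately have "inv g' \<otimes> (s \<otimes> g) \<in> H"
      using g g' s by (intro M_ht_0) auto
    from common_H[OF g'(1) this] show ?thesis using g g' s by simp
  qed
  have bwd: "inv s \<otimes> g \<in> common S" if g: "g \<in> common S" and s: "s \<in> pos S" for g s
  proof -
    obtain g' where g': "g' \<in> common S" "ht g' = ht g + (- ht s)" using level[OF g] by blast
    have "inv (s \<otimes> g') \<otimes> g \<in> H"
      using fwd[OF g'(1) s] g g' s by (intro unique) auto
    from common_H[OF g'(1) this] show ?thesis using g g' s by (simp add: inv_mult_group m_assoc)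
  qed
  have inv_pos: "inv s \<in> pos S" if "s \<in> S" "s \<notin> pos S" for s
    using that S'(2) unfolding pos_def by auto
  have act: "\<forall>g\<in>common S. u \<otimes> g \<in> common S" if "u \<in> generate G S" for u
    using that
  proof (induction rule: generate.induct)
    case one
    then show ?case by simp
  next
    case (incl s)
    then show ?case using fwd bwd[OF _ inv_pos] S'(2) by (metis inv_inv subsetD)
  next
    case (inv s)
    then show ?case using bwd fwd[OF _ inv_pos] by blast
  next
    case (eng u v)
    then have "u \<in> carrier G" "v \<in> carrier G" using S'(3) by auto
    then show ?case using eng by (simp add: m_assoc)
  qed
  obtain g0 where g0: "g0 \<in> common S"
  proof -
    have "finite (pos S)" using S'(1) unfolding pos_def by auto
    then obtain i where i: "i \<ge> 0" "\<And>u. u \<in> pos S \<Longrightarrow> T i \<otimes> u \<otimes> T (- i) \<in> M"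
      using eventually_in_M[of "pos S"] pos_closed by blast
    then have "T (- i) \<in> common S" by (intro commonI) simp_all
    then show thesis by (rule that)
  qed
  have all: "c \<in> common S" if "c \<in> carrier G" for c
  proof -
    have "c \<otimes> inv g0 \<in> generate G S" using S'(3) g0 that by simp
    then have "c \<otimes> inv g0 \<otimes> g0 \<in> common S" using act g0 by blast
    then show ?thesis using g0 that by (simp add: m_assoc)
  qed
  obtain h where h: "h \<in> H" "inv t \<otimes> h \<otimes> t \<notin> H" using conj_t_proper by blast
  have "inv t \<otimes> (h \<otimes> t) \<in> H" using h by (intro unique all) (auto simp: ht_H)
  then show False using h by (simp add: m_assoc)
qed

section \<open>Elements with disjoint subtrees\<close>

text \<open>The elements of \<open>M\<close> of positive height.\<close>

definition Mp :: "'a set" where "Mp = {g \<in> M. ht g > 0}"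

lemma Mp_M: "g \<in> Mp \<Longrightarrow> g \<in> M" and Mp_ht: "g \<in> Mp \<Longrightarrow> ht g > 0"
  and Mp_I: "g \<in> M \<Longrightarrow> ht g > 0 \<Longrightarrow> g \<in> Mp"
  by (simp_all add: Mp_def)

lemma Mp_closed [simp]: "g \<in> Mp \<Longrightarrow> g \<in> carrier G"
  by (simp add: Mp_def)

lemma Mp_mult:
  assumes "g \<in> Mp" "u \<in> M" shows "g \<otimes> u \<in> Mp" "D (g \<otimes> u) = D g"
  using assms M_ht[of u] M_mult[of g u] D_mult[of g u] by (auto simp: Mp_def)

lemma Mp_quotient:
  assumes "u \<in> Mp" "v \<in> M" "ht v < ht u"
  shows "u \<otimes> inv v \<in> Mp" "D (u \<otimes> inv v) = D u"
proof -
  show *: "u \<otimes> inv v \<in> Mp"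
    using assms M_quotient[OF Mp_M[OF assms(1)] assms(2)] by (intro Mp_I) simp_all
  have "D (u \<otimes> inv v \<otimes> v) = D (u \<otimes> inv v)"
    using * assms(2) by (rule Mp_mult)
  then show "D (u \<otimes> inv v) = D u"
    using assms by (simp add: m_assoc)
qed

lemma Mp_H:
  assumes "k \<in> H" "g \<in> Mp" shows "k \<otimes> g \<in> Mp"
  using assms M_mult[OF H_subset_M Mp_M, of k g] Mp_ht[of g] by (intro Mp_I) (simp_all add: ht_H)

lemma D_B:
  assumes "b \<in> B" "g \<in> M" shows "D (b \<otimes> g) = D g"
proof -
  define h where "h = g \<otimes> T (- ht g)"
  have h: "h \<in> H" using assms unfolding h_def M_def by auto
  note bH [simp] = B_subset_H[OF assms(1)]
  have "inv h \<otimes> b \<otimes> h \<in> B" using assms(1) h by (rule B_conj)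
  also have "inv h \<otimes> b \<otimes> h = inv (g \<otimes> T (- ht g)) \<otimes> (b \<otimes> g \<otimes> T (- ht (b \<otimes> g)))"
    using assms h by (simp add: m_assoc ht_H h_def)
  finally have "inv (g \<otimes> T (- ht g)) \<otimes> (b \<otimes> g \<otimes> T (- ht (b \<otimes> g))) \<in> B" .
  moreover have "b \<otimes> g \<in> M" using assms(2) by (intro M_mult[OF H_subset_M]) simp
  ultimately have "D g = D (b \<otimes> g)" using D_eq_iff[OF assms(2)] by blast
  then show ?thesis ..
qed

lemma apart_Mp: "g \<in> Mp \<Longrightarrow> g' \<in> Mp \<Longrightarrow> D g \<noteq> D g' \<Longrightarrow> apart M g g'"
  unfolding Mp_def by (simp add: apart_D)

text \<open>
  If \<open>u\<close> lies below the child \<open>D \<alpha>\<close> and \<open>w\<close> below the child \<open>D \<beta>\<close>, then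
  \<open>\<alpha> \<beta>\<inverse> u\<close> and \<open>w\<close> lie in disjoint subtrees.
  For heights \<open>ht \<alpha> \<noteq> ht \<beta>\<close> this is a comparison of branches.  If the heights are equal, then
  \<open>\<alpha> \<beta>\<inverse>\<close> is an elliptic element that rotates the children and takes \<open>D \<beta>\<close> to
  \<open>D \<alpha>\<close>, so it cannot take \<open>D \<alpha>\<close> back to \<open>D \<beta>\<close>, as \<open>p\<close> is odd.
\<close>
lemma apart_quotient:
  assumes al: "\<alpha> \<in> Mp" and be: "\<beta> \<in> Mp" and u: "u \<in> Mp" "D u = D \<alpha>" and w: "w \<in> Mp" "D w = D \<beta>"
    and ne: "D \<alpha> \<noteq> D \<beta>" and p: "p \<noteq> 2"
  shows "apart M (\<alpha> \<otimes> (inv \<beta> \<otimes> u)) w"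
proof -
  define k where "k = \<alpha> \<otimes> inv \<beta>"
  have k [simp]: "k \<in> carrier G" using al be by (simp add: k_def)
  have htk: "ht k = ht \<alpha> - ht \<beta>" using al be by (simp add: k_def)
  have "apart M (k \<otimes> u) w"
  proof (cases "ht \<alpha>" "ht \<beta>" rule: linorder_cases)
    case greater
    then have "k \<in> Mp" "D k = D \<alpha>"
      unfolding k_def by (rule Mp_quotient[OF al Mp_M[OF be]])+
    then show ?thesis using u w ne Mp_mult[of k u] by (intro apart_Mp) (auto simp: Mp_M)
  next
    case less
    have kinv: "inv k = \<beta> \<otimes> inv \<alpha>" using al be by (simp add: k_def inv_mult_group)
    have "inv k \<in> Mp" "D (inv k) = D \<beta>"
      unfolding kinv by (rule Mp_quotient[OF be Mp_M[OF al] less])+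
    then have "apart M u (inv k \<otimes> w)"
      using u w ne Mp_mult[of "inv k" w] by (intro apart_Mp) (auto simp: Mp_M)
    then have "apart M (k \<otimes> u) (k \<otimes> (inv k \<otimes> w))"
      using u w by (intro apart_cancel) auto
    then show ?thesis using w by simp
  next
    case equal
    have kH: "k \<in> H"
      using al be equal htk unfolding k_def by (intro M_ht_0 M_quotient) (auto simp: Mp_M)
    have kb: "D (k \<otimes> \<beta>) = D \<alpha>" using al be by (simp add: k_def m_assoc)
    have kB: "k \<notin> B" using kb D_B[of k \<beta>] be ne Mp_M by auto
    have k2: "k [^] (2::int) = k \<otimes> k" "k [^] (0::int) = \<one>"
      using int_pow_mult[OF k, of 1 1] by (simp_all add: int_pow_1)
    have "D (k \<otimes> u) = D (k \<otimes> (k \<otimes> \<beta>))"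
      using kH kb u al be by (intro D_H_cong) (auto intro: M_mult H_subset_M simp: Mp_M)
    also have "\<dots> \<noteq> D \<beta>"
    proof
      assume "D (k \<otimes> (k \<otimes> \<beta>)) = D \<beta>"
      then have "D (k [^] (0::int) \<otimes> \<beta>) = D (k [^] (2::int) \<otimes> \<beta>)"
        unfolding k2 using be by (simp add: m_assoc)
      then have "int p dvd 2 - 0" using kH kB be by (intro D_pow_eq[of k \<beta>]) (auto simp: Mp_M)
      then have "int p dvd int 2" by simp
      then have "p dvd 2" by (simp only: int_dvd_int_iff)
      then show False using p prime_p by (metis primes_dvd_imp_eq two_is_prime_nat)
    qed
    finally show ?thesis
      using u w kH by (intro apart_Mp Mp_H) auto
  qed
  then show ?thesis using al be u by (simp add: k_def m_assoc)
qed

text \<open>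
  A list of elements that send the base vertex into disjoint subtrees below it.
\<close>
definition free :: "'a list \<Rightarrow> bool" where
  "free F \<longleftrightarrow> set F \<subseteq> Mp \<and> sorted_wrt (apart M) F"

lemma free_Nil [simp]: "free []"
  by (simp add: free_def)

lemma free_Cons: "free (c # F) \<longleftrightarrow> c \<in> Mp \<and> (\<forall>d\<in>set F. apart M c d) \<and> free F"
  by (auto simp: free_def)

lemma free_append:
  "free (F @ F') \<longleftrightarrow> free F \<and> free F' \<and> (\<forall>c\<in>set F. \<forall>d\<in>set F'. apart M c d)"
  by (auto simp: free_def sorted_wrt_append)

lemma free_shift:
  assumes "free F" "P \<in> M" shows "free (map ((\<otimes>) P) F)"
  using assms(1)
proof (induction F)
  case (Cons c F)
  then have c: "c \<in> Mp" "\<And>d. d \<in> set F \<Longrightarrow> d \<in> Mp \<and> apart M c d" "free F"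
    by (auto simp: free_Cons free_def)
  have "P \<otimes> c \<in> Mp" using c assms(2) M_ht[of P] Mp_ht[of c] by (intro Mp_I M_mult) (auto simp: Mp_M)
  then show ?case using Cons.IH c assms(2) by (auto simp: free_Cons intro!: apart_cancel)
qed simp

lemma free_powers:
  assumes a: "a \<in> H" "a \<notin> B" and x: "x \<in> Mp"
    and I: "distinct I" "\<And>i j. i \<in> set I \<Longrightarrow> j \<in> set I \<Longrightarrow> i \<noteq> j \<Longrightarrow> \<not> int p dvd j - i"
  shows "free (map (\<lambda>i::int. a [^] i \<otimes> x) I)"
  using I
proof (induction I)
  case (Cons i I)
  have ai: "a [^] i \<otimes> x \<in> Mp" for i :: int
    using a x subgroup_H by (intro Mp_H) (auto simp: subgroup_int_pow_closed)
  have "apart M (a [^] i \<otimes> x) (a [^] j \<otimes> x)" if "j \<in> set I" for j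
  proof -
    have "\<not> int p dvd j - i" using Cons.prems that by auto
    then have "D (a [^] i \<otimes> x) \<noteq> D (a [^] j \<otimes> x)"
      using D_pow_eq[OF a, of x i j] x Mp_M by blast
    then show ?thesis using ai by (intro apart_Mp)
  qed
  then show ?case using Cons ai by (simp add: free_Cons)
qed simp

end

text \<open>
  A finite generating set \<open>S\<close>, studied at the vertex \<open>g H\<close>.  By conjugation with \<open>g\<close> this becomes
  the base vertex.
\<close>
locale hnn_generators = ascending_hnn G H t ht p for G (structure) and H t ht p +
  fixes S :: "'a set" and g :: 'a
  assumes S: "S \<in> fin_gen_sets G" and g [simp]: "g \<in> carrier G"
begin

text \<open>
  The conjugate of \<open>u\<close> by \<open>g\<close> has word length at most \<open>n\<close>.
\<close>
definition len :: "'a \<Rightarrow> nat \<Rightarrow> bool" where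
  "len u n \<longleftrightarrow> u \<in> carrier G \<and> g \<otimes> u \<otimes> inv g \<in> reach G S n"

lemma S_closed: "S \<subseteq> carrier G"
  using S by (simp add: fin_gen_sets_def)

lemma len_one: "len \<one> 0"
  using one_in_reach[OF S_closed] by (simp add: len_def)

lemma len_mult:
  assumes "len u m" "len v n" shows "len (u \<otimes> v) (m + n)"
proof -
  have "(g \<otimes> u \<otimes> inv g) \<otimes> (g \<otimes> v \<otimes> inv g) \<in> reach G S (m + n)"
    using assms by (intro reach_mult[OF S_closed]) (auto simp: len_def)
  moreover have "(g \<otimes> u \<otimes> inv g) \<otimes> (g \<otimes> v \<otimes> inv g) = g \<otimes> (u \<otimes> v) \<otimes> inv g"
    using assms by (simp add: len_def m_assoc)
  ultimately show ?thesis using assms by (simp add: len_def)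
qed

lemma len_nat_pow: "len a m \<Longrightarrow> len (a [^] (n::nat)) (n * m)"
proof (induction n)
  case (Suc n)
  then have "len (a [^] n \<otimes> a) (n * m + m)" by (intro len_mult)
  then show ?case by (simp add: add.commute)
qed (simp add: len_one)

lemma len_letter:
  assumes "s \<in> pos S"
  shows "len (inv g \<otimes> s \<otimes> g) 1" "len (inv (inv g \<otimes> s \<otimes> g)) 1"
proof -
  have s: "s \<in> S \<union> m_inv G ` S" "s \<in> carrier G" using assms S_closed by (auto simp: pos_def)
  then have s': "inv s \<in> S \<union> m_inv G ` S" using S_closed by auto
  have "g \<otimes> (inv g \<otimes> s \<otimes> g) \<otimes> inv g = s" "g \<otimes> inv (inv g \<otimes> s \<otimes> g) \<otimes> inv g = inv s"
    using s(2) by (simp_all add: m_assoc inv_mult_group)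
  then show "len (inv g \<otimes> s \<otimes> g) 1" "len (inv (inv g \<otimes> s \<otimes> g)) 1"
    using letter_in_reach[OF S_closed s(1)] letter_in_reach[OF S_closed s'] s(2)
    by (simp_all add: len_def)
qed

text \<open>
  A free list whose elements come with upper bounds for their lengths.
\<close>
definition code :: "('a \<times> nat) list \<Rightarrow> bool" where
  "code C \<longleftrightarrow> free (map fst C) \<and> (\<forall>(c, l)\<in>set C. l \<ge> 1 \<and> len c l)"

lemma code_growth:
  assumes "code C" "wt z C \<ge> 1" "0 < z" "z \<le> 1"
  shows "growth_rate G S \<ge> 1 / z"
proof (rule growth_rate_code[OF S assms(3,4) _ M_one g _ M_mult])
  show "M \<subseteq> carrier G" by auto
  show "c \<in> M \<and> 1 \<le> l \<and> g \<otimes> c \<otimes> inv g \<in> reach G S l" if "(c, l) \<in> set C" for c l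
    using that assms(1) by (force simp: code_def free_def len_def intro: Mp_M)
  show "sorted_wrt (\<lambda>a b. apart M (fst a) (fst b)) C"
    using assms(1) by (simp add: code_def free_def sorted_wrt_map)
qed (use assms in auto)

text \<open>
  The code with all elements multiplied by \<open>P\<close> from the left, where \<open>P\<close> has length \<open>n\<close>.
\<close>
definition shift :: "'a \<Rightarrow> nat \<Rightarrow> ('a \<times> nat) list \<Rightarrow> ('a \<times> nat) list" where
  "shift P n C = map (\<lambda>(c, l). (P \<otimes> c, n + l)) C"

lemma fst_shift: "map fst (shift P n C) = map ((\<otimes>) P) (map fst C)"
  by (simp add: shift_def case_prod_unfold)

lemma code_append:
  "code (C @ C') \<longleftrightarrow> code C \<and> code C' \<and> (\<forall>c\<in>fst ` set C. \<forall>d\<in>fst ` set C'. apart M c d)"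
  unfolding code_def map_append free_append set_append ball_Un set_map by blast

lemma code_shift:
  assumes "code C" "P \<in> M" "len P n" shows "code (shift P n C)"
proof -
  have "free (map ((\<otimes>) P) (map fst C))"
    using assms by (intro free_shift) (auto simp: code_def)
  moreover have "l \<ge> 1 \<and> len c l" if "(c, l) \<in> set (shift P n C)" for c l
    using that assms unfolding code_def shift_def by (force intro: len_mult)
  ultimately show ?thesis unfolding code_def fst_shift by blast
qed

lemma wt_append [simp]: "wt z (C @ C') = wt z C + wt z C'"
  by (simp add: wt_def)

lemma wt_Cons [simp]: "wt z ((c, l) # C) = z ^ l + wt z C"
  by (simp add: wt_def)

lemma wt_Nil [simp]: "wt z [] = 0"
  by (simp add: wt_def)

lemma wt_shift [simp]: "wt z (shift P n C) = z ^ n * wt z C"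
proof (induction C)
  case (Cons a C)
  obtain c l where "a = (c, l)" by (cases a)
  then have "shift P n (a # C) = (P \<otimes> c, n + l) # shift P n C" by (simp add: shift_def)
  then show ?case using Cons \<open>a = (c, l)\<close> by (simp add: power_add distrib_left)
qed (simp add: shift_def)

text \<open>
  If no element of the code \<open>V\<close> lies below the child \<open>D P\<close>, then \<open>V\<close>, \<open>P V\<close>, \<open>P\<^sup>2 V\<close> and
  \<open>P\<^sup>3 V\<close> together form a code.  Here \<open>V1\<close> is \<open>P V\<close> with lengths that take cancellation
  into account.
\<close>
lemma code_tower:
  assumes V: "code V" "\<And>v. v \<in> fst ` set V \<Longrightarrow> D v \<noteq> D P"
    and V1: "code V1" "map fst V1 = map ((\<otimes>) P) (map fst V)"
    and P: "P \<in> Mp" "len P 2"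
  shows "\<exists>C. code C \<and> wt z C = wt z V + (1 + z ^ 2 + z ^ 4) * wt z V1"
proof -
  define C where "C = V @ V1 @ shift P 2 V1 @ shift P 2 (shift P 2 V1)"
  define F where "F = map fst V"
  have F: "free F" "\<And>v. v \<in> set F \<Longrightarrow> D v \<noteq> D P"
    using V by (auto simp: F_def code_def)
  have step: "free (F @ map ((\<otimes>) P) W)" if W: "free W" for W
  proof -
    have "apart M v (P \<otimes> w)" if "v \<in> set F" "w \<in> set W" for v w
    proof (rule apart_Mp)
      show "v \<in> Mp" using F(1) that by (auto simp: free_def)
      have "w \<in> M" using W that by (auto simp: free_def Mp_M)
      from Mp_mult[OF P(1) this] show "P \<otimes> w \<in> Mp" "D v \<noteq> D (P \<otimes> w)"
        using F(2) that by auto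
    qed
    then show ?thesis using F(1) free_shift[OF W Mp_M[OF P(1)]] by (auto simp: free_append)
  qed
  have "map fst C = F @ map ((\<otimes>) P) (F @ map ((\<otimes>) P) (F @ map ((\<otimes>) P) F))"
    by (simp add: C_def fst_shift V1(2) F_def)
  then have free: "free (map fst C)" by (simp only: step F(1))
  have "code (shift P 2 V1)" "code (shift P 2 (shift P 2 V1))"
    using V1(1) P by (auto intro!: code_shift simp: Mp_M)
  then have "code C"
    using free V(1) V1(1) by (auto simp: code_def C_def)
  moreover have "wt z C = wt z V + (1 + z ^ 2 + z ^ 4) * wt z V1"
    by (simp add: C_def algebra_simps flip: power_add)
  ultimately show ?thesis by blast
qed

section \<open>Growth from explicit codes\<close>

lemma growth_powers:
  assumes a: "a \<in> H" "a \<notin> B" and x: "x \<in> Mp"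
    and I: "distinct I" "\<And>i j. i \<in> set I \<Longrightarrow> j \<in> set I \<Longrightarrow> i \<noteq> j \<Longrightarrow> \<not> int p dvd j - i"
    and L: "\<And>i. i \<in> set I \<Longrightarrow> L i \<ge> 1 \<and> len (a [^] (i::int) \<otimes> x) (L i)"
    and z: "(\<Sum>i\<leftarrow>I. z ^ L i) \<ge> 1" "0 < z" "z \<le> 1"
  shows "growth_rate G S \<ge> 1 / z"
proof -
  define C where "C = map (\<lambda>i. (a [^] i \<otimes> x, L i)) I"
  have "map fst C = map (\<lambda>i. a [^] i \<otimes> x) I" by (simp add: C_def comp_def)
  then have "code C"
    using free_powers[OF a x I] L by (auto simp: code_def C_def comp_def)
  moreover have "wt z C = (\<Sum>i\<leftarrow>I. z ^ L i)"
    by (simp add: wt_def C_def comp_def)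
  ultimately show ?thesis using z by (intro code_growth) auto
qed

lemma growth_powers_odd:
  assumes a: "a \<in> H" "a \<notin> B" and x: "x \<in> Mp" and p: "p = 2 * k + 1"
    and L: "\<And>i. L i \<ge> 1" "\<And>i. \<bar>i\<bar> \<le> int k \<Longrightarrow> len (a [^] (i::int) \<otimes> x) (L i)"
    and z: "z ^ L 0 + (\<Sum>j<k. z ^ L (int (Suc j))) + (\<Sum>j<k. z ^ L (- int (Suc j))) \<ge> 1" "0 < z" "z \<le> 1"
  shows "growth_rate G S \<ge> 1 / z"
proof (rule growth_powers[OF a x])
  define I where "I = 0 # map (\<lambda>j. int (Suc j)) [0..<k] @ map (\<lambda>j. - int (Suc j)) [0..<k]"
  have bound: "\<bar>i\<bar> \<le> int k" if "i \<in> set I" for i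
    using that by (auto simp: I_def)
  show "distinct I" by (auto simp: I_def distinct_map inj_on_def)
  show "\<not> int p dvd j - i" if "i \<in> set I" "j \<in> set I" "i \<noteq> j" for i j
  proof
    assume "int p dvd j - i"
    then have "int p \<le> \<bar>j - i\<bar>" using that(3) by (intro zdvd_imp_le) auto
    then show False using bound[OF that(1)] bound[OF that(2)] p by linarith
  qed
  show "L i \<ge> 1 \<and> len (a [^] i \<otimes> x) (L i)" if "i \<in> set I" for i
    using L bound[OF that] by blast
  have "(\<Sum>i\<leftarrow>I. z ^ L i) = z ^ L 0 + (\<Sum>j<k. z ^ L (int (Suc j))) + (\<Sum>j<k. z ^ L (- int (Suc j)))"
    by (simp add: I_def comp_def interv_sum_list_conv_sum_set_nat atLeast0LessThan add.assoc
        del: of_nat_Suc)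
  then show "(\<Sum>i\<leftarrow>I. z ^ L i) \<ge> 1" using z by simp
qed (use z in auto)

lemma len_int_pow:
  assumes "len a n" "len (inv a) n"
  shows "len (a [^] (i::int)) (nat \<bar>i\<bar> * n)"
proof (cases i rule: int_cases2)
  case (nonneg m)
  then show ?thesis using len_nat_pow[OF assms(1), of m] by (simp add: int_pow_int)
next
  case (nonpos m)
  have "a \<in> carrier G" using assms(1) by (simp add: len_def)
  then have "a [^] i = inv a [^] m" using nonpos by (simp add: int_pow_neg int_pow_int nat_pow_inv)
  then show ?thesis using len_nat_pow[OF assms(2), of m] nonpos by simp
qed

lemma growth_elliptic_two:
  assumes a: "a \<in> H" "a \<notin> B" "len a 1" and x: "x \<in> Mp" "len x 1" and p: "p = 2"
    and z: "z + z ^ 2 = 1" "0 < z" "z \<le> 1"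
  shows "growth_rate G S \<ge> 1 / z"
proof (rule growth_powers[OF a(1,2) x(1), of "[0, 1]" "\<lambda>i. nat i + 1"])
  show "\<not> int p dvd j - i" if "i \<in> set [0, 1]" "j \<in> set [0, 1]" "i \<noteq> j" for i j
    using that p by auto
  show "nat i + 1 \<ge> 1 \<and> len (a [^] i \<otimes> x) (nat i + 1)" if "i \<in> set [0, 1]" for i :: int
    using that len_mult[OF a(3) x(2)] a x by (auto simp: int_pow_1)
qed (use z in \<open>auto simp: power2_eq_square\<close>)

lemma growth_elliptic_odd:
  assumes a: "a \<in> H" "a \<notin> B" "len a 1" "len (inv a) 1" and x: "x \<in> Mp" "len x 1" and p: "p = 2 * k + 1"
    and z: "z + 2 * (\<Sum>j<k. z ^ (j + 2)) = 1" "0 < z" "z \<le> 1"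
  shows "growth_rate G S \<ge> 1 / z"
proof (rule growth_powers_odd[OF a(1,2) x(1) p, of "\<lambda>i. nat \<bar>i\<bar> + 1"])
  show "len (a [^] i \<otimes> x) (nat \<bar>i\<bar> + 1)" for i :: int
    using len_mult[OF len_int_pow[OF a(3,4), of i] x(2)] by simp
  have "nat \<bar>int (Suc j)\<bar> + 1 = j + 2" "nat \<bar>- int (Suc j)\<bar> + 1 = j + 2" for j by auto
  then show "z ^ (nat \<bar>0\<bar> + 1) + (\<Sum>j<k. z ^ (nat \<bar>int (Suc j)\<bar> + 1)) +
      (\<Sum>j<k. z ^ (nat \<bar>- int (Suc j)\<bar> + 1)) \<ge> 1"
    using z(1) by (simp only:) simp
qed (use z in auto)

text \<open>
  If \<open>x\<close> and \<open>y\<close> have the same height, then \<open>a = y x\<inverse>\<close> lies in \<open>H - B\<close>, and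
  \<open>a\<^sup>i x\<close> with \<open>i > 0\<close> has length \<open>2 i - 1\<close> only, because it equals \<open>a\<^sup>i\<^sup>-\<^sup>1 y\<close>.
\<close>

lemma growth_equal_height:
  assumes x: "x \<in> Mp" "len x 1" "len (inv x) 1" and y: "y \<in> Mp" "len y 1" "len (inv y) 1"
    and ht: "ht x = ht y" and D: "D x \<noteq> D y" and p: "p = 2 * k + 1"
    and z: "z + (\<Sum>j<k. z ^ (2 * j + 1)) + (\<Sum>j<k. z ^ (2 * j + 3)) \<ge> 1" "0 < z" "z \<le> 1"
  shows "growth_rate G S \<ge> 1 / z"
proof -
  define a where "a = y \<otimes> inv x"
  have a_closed [simp]: "a \<in> carrier G" using x y by (simp add: a_def)
  have aH: "a \<in> H"
    using x y ht M_quotient[of y x] unfolding a_def by (intro M_ht_0) (auto simp: Mp_M)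
  have ax: "a \<otimes> x = y" using x y by (simp add: a_def m_assoc)
  have aB: "a \<notin> B" using D_B[of a x] D x Mp_M ax by auto
  have la: "len a 2" "len (inv a) 2"
    using len_mult[OF y(2) x(3)] len_mult[OF x(2) y(3)] x y
    by (simp_all add: a_def inv_mult_group numeral_2_eq_2)
  define L where "L i = (if i > 0 then nat (2 * i - 1) else nat (1 - 2 * i))" for i :: int
  show ?thesis
  proof (rule growth_powers_odd[OF aH aB x(1) p, of L])
    show "L i \<ge> 1" for i by (auto simp: L_def)
    show "len (a [^] i \<otimes> x) (L i)" for i
    proof (cases "i > 0")
      case True
      have "a [^] i \<otimes> x = a [^] (i - 1) \<otimes> (a \<otimes> x)"
        using x int_pow_mult[of a "i - 1" 1] by (simp add: int_pow_1 m_assoc)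
      moreover have "len (a [^] (i - 1) \<otimes> (a \<otimes> x)) (nat \<bar>i - 1\<bar> * 2 + 1)"
        unfolding ax by (rule len_mult[OF len_int_pow[OF la] y(2)])
      moreover have "nat \<bar>i - 1\<bar> * 2 + 1 = L i" using True by (auto simp: L_def)
      ultimately show ?thesis by simp
    next
      case False
      then have "nat \<bar>i\<bar> * 2 + 1 = L i" by (auto simp: L_def)
      then show ?thesis using len_mult[OF len_int_pow[OF la, of i] x(2)] by simp
    qed
    have "L (int (Suc j)) = 2 * j + 1" "L (- int (Suc j)) = 2 * j + 3" "L 0 = 1" for j
      by (auto simp: L_def)
    then show "z ^ L 0 + (\<Sum>j<k. z ^ L (int (Suc j))) + (\<Sum>j<k. z ^ L (- int (Suc j))) \<ge> 1"
      using z(1) by (simp only:) simp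
  qed (use z in auto)
qed

text \<open>
  Here \<open>x\<close> and \<open>y\<close> generate a free monoid.
\<close>
lemma growth_two_hyperbolic:
  assumes x: "x \<in> Mp" "len x 1" and y: "y \<in> Mp" "len y 1" and D: "D x \<noteq> D y"
    and z: "2 * z \<ge> 1" "z \<le> 1"
  shows "growth_rate G S \<ge> 1 / z"
proof (rule code_growth[of "[(x, 1), (y, 1)]"])
  show "code [(x, 1), (y, 1)]"
    using x y D by (auto simp: code_def free_Cons intro: apart_Mp)
qed (use z in auto)

context
  fixes x y :: 'a
  assumes x: "x \<in> Mp" "len x 1" "len (inv x) 1" and y: "y \<in> Mp" "len y 1" "len (inv y) 1"
    and D: "D x \<noteq> D y" and ht: "ht y < ht x" and p: "p > 2"
begin

text \<open>
  Two hyperbolic generators of different heights whose axes part at the base vertex.  In each of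
  the cases \<open>ht x < 2 ht y\<close>, \<open>ht x = 2 ht y\<close> and \<open>ht x > 2 ht y\<close> a different code in \<open>x\<close>
  and \<open>y\<close> has weight at least \<open>1\<close> at \<open>q = \<surd>2 - 1\<close>.  Weights are linear in \<open>q\<close> because
  \<open>q\<^sup>2 = 1 - 2 q\<close>.
\<close>
definition q :: real where "q = sqrt 2 - 1"

lemma q_bounds: "0.4142135 < q" "q < 0.4142136"
proof -
  have "1.4142135 < sqrt 2" by (rule real_less_rsqrt) (simp add: power2_eq_square)
  then show "0.4142135 < q" by (simp add: q_def)
  have "sqrt 2 < 1.4142136" by (rule real_less_lsqrt) (simp_all add: power2_eq_square)
  then show "q < 0.4142136" by (simp add: q_def)
qed

lemma q_powers:
  "q ^ 2 = 1 - 2 * q" "q ^ 3 = 5 * q - 2" "q ^ 4 = 5 - 12 * q" "q ^ 5 = 29 * q - 12" "q ^ 6 = 29 - 70 * q"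
proof -
  have q2: "q * q = 1 - 2 * q" by (simp add: q_def algebra_simps)
  show "q ^ 2 = 1 - 2 * q" by (simp add: power2_eq_square q2)
  show "q ^ 3 = 5 * q - 2" using q2 by Groebner_Basis.algebra
  show "q ^ 4 = 5 - 12 * q" using q2 by Groebner_Basis.algebra
  show "q ^ 5 = 29 * q - 12" using q2 by Groebner_Basis.algebra
  show "q ^ 6 = 29 - 70 * q" using q2 by Groebner_Basis.algebra
qed

lemmas [simp] = Mp_closed[OF x(1)] Mp_closed[OF y(1)]

text \<open>
  The element \<open>x y\<inverse>\<close> moves the base vertex below the same child as \<open>x\<close>, but less far.
\<close>
lemma P: "x \<otimes> inv y \<in> Mp" "D (x \<otimes> inv y) = D x" "len (x \<otimes> inv y) 2"
  using Mp_quotient[OF x(1) Mp_M[OF y(1)] ht] len_mult[OF x(2) y(3)] by (simp_all add: numeral_2_eq_2)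

lemma quotient_word:
  assumes "u \<in> Mp" "v \<in> M" "ht v < ht u" "w \<in> M"
  shows "u \<otimes> (inv v \<otimes> w) \<in> Mp" "D (u \<otimes> (inv v \<otimes> w)) = D u"
  using Mp_mult[OF Mp_quotient(1)[OF assms(1-3)] assms(4)] Mp_quotient(2)[OF assms(1-3)] assms
  by (simp_all add: m_assoc Mp_closed)

lemma Mp_mult2: "u \<in> Mp \<Longrightarrow> v \<in> Mp \<Longrightarrow> u \<otimes> v \<in> Mp" "u \<in> Mp \<Longrightarrow> v \<in> Mp \<Longrightarrow> D (u \<otimes> v) = D u"
  using Mp_mult Mp_M by blast+

lemma lens:
  "len (x \<otimes> (y \<otimes> (inv x \<otimes> y))) 4"
  "len (x \<otimes> (y \<otimes> (y \<otimes> (inv x \<otimes> y)))) 5"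
  "len (y \<otimes> (y \<otimes> (inv x \<otimes> y))) 4"
  "len (x \<otimes> (x \<otimes> (inv y \<otimes> (inv y \<otimes> x)))) 5"
  "len (y \<otimes> (x \<otimes> (inv y \<otimes> (inv y \<otimes> x)))) 5"
  "len (x \<otimes> (inv y \<otimes> (inv y \<otimes> x))) 4"
  "len (x \<otimes> (inv y \<otimes> inv y)) 3"
  "len (x \<otimes> (inv y \<otimes> (x \<otimes> (inv y \<otimes> (inv y \<otimes> x))))) 6"
  using len_mult[OF x(2) len_mult[OF y(2) len_mult[OF x(3) y(2)]]]
    len_mult[OF x(2) len_mult[OF y(2) len_mult[OF y(2) len_mult[OF x(3) y(2)]]]]
    len_mult[OF y(2) len_mult[OF y(2) len_mult[OF x(3) y(2)]]]
    len_mult[OF x(2) len_mult[OF x(2) len_mult[OF y(3) len_mult[OF y(3) x(2)]]]]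
    len_mult[OF y(2) len_mult[OF x(2) len_mult[OF y(3) len_mult[OF y(3) x(2)]]]]
    len_mult[OF x(2) len_mult[OF y(3) len_mult[OF y(3) x(2)]]]
    len_mult[OF x(2) len_mult[OF y(3) y(3)]]
    len_mult[OF x(2) len_mult[OF y(3) len_mult[OF x(2) len_mult[OF y(3) len_mult[OF y(3) x(2)]]]]]
  by (simp_all add: eval_nat_numeral)

text \<open>
  The words \<open>y\<close>, \<open>y y x\<inverse> y\<close> and \<open>y x y\<inverse> y\<inverse> x\<close> lie below the child \<open>D y\<close>, in disjoint
  subtrees, so the tower over them with \<open>P = x y\<inverse>\<close> is a code.  The first two levels both have lengths
  \<open>1, 4, 5\<close>.
\<close>
lemma growth_height_less_double:
  assumes "ht x < 2 * ht y"
  shows "growth_rate G S \<ge> 1 / q"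
proof -
  let ?v2 = "y \<otimes> (y \<otimes> (inv x \<otimes> y))" and ?v3 = "y \<otimes> (x \<otimes> (inv y \<otimes> (inv y \<otimes> x)))"
  let ?V = "[(y, 1::nat), (?v2, 4), (?v3, 5)]"
  let ?V1 = "[(x, 1::nat), (x \<otimes> (y \<otimes> (inv x \<otimes> y)), 4), (x \<otimes> (x \<otimes> (inv y \<otimes> (inv y \<otimes> x))), 5)]"
  have yy: "y \<otimes> y \<in> Mp" "D (y \<otimes> y) = D y" and yx: "y \<otimes> x \<in> Mp" "D (y \<otimes> x) = D y"
    using Mp_mult2 x y by auto
  have Q: "y \<otimes> y \<otimes> inv x \<in> Mp" "D (y \<otimes> y \<otimes> inv x) = D y"
    using Mp_quotient[OF yy(1) Mp_M[OF x(1)]] yy assms by simp_all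
  have R: "y \<otimes> x \<otimes> inv (y \<otimes> y) \<in> Mp" "D (y \<otimes> x \<otimes> inv (y \<otimes> y)) = D y"
    using Mp_quotient[OF yx(1) Mp_M[OF yy(1)]] yx ht by simp_all
  have v2: "?v2 \<in> Mp" "D ?v2 = D y"
    using Mp_mult2[OF Q(1) y(1)] Q by (simp_all add: m_assoc)
  have v3: "?v3 \<in> Mp" "D ?v3 = D y"
    using Mp_mult2[OF R(1) x(1)] R by (simp_all add: m_assoc inv_mult_group)
  have "apart M (y \<otimes> y \<otimes> inv x \<otimes> (x \<otimes> inv y)) (y \<otimes> y \<otimes> inv x \<otimes> y)"
    using P y D by (intro apart_cancel apart_Mp) auto
  then have a12: "apart M y ?v2" by (simp add: m_assoc)
  have "apart M (y \<otimes> x \<otimes> inv (y \<otimes> y) \<otimes> (y \<otimes> y \<otimes> inv x)) (y \<otimes> x \<otimes> inv (y \<otimes> y) \<otimes> x)"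
    using Q x D by (intro apart_cancel apart_Mp) auto
  then have a13: "apart M y ?v3" by (simp add: m_assoc inv_mult_group)
  have xyx: "x \<otimes> (inv y \<otimes> x) \<in> Mp" "D (x \<otimes> (inv y \<otimes> x)) = D x"
    using quotient_word[OF x(1) Mp_M[OF y(1)] ht Mp_M[OF x(1)]] by simp_all
  have "apart M ((x \<otimes> (inv y \<otimes> x)) \<otimes> (inv (y \<otimes> y) \<otimes> x)) y"
    using xyx yy x y D p by (intro apart_quotient) auto
  then have "apart M (y \<otimes> y \<otimes> inv x \<otimes> ((x \<otimes> (inv y \<otimes> x)) \<otimes> (inv (y \<otimes> y) \<otimes> x))) (y \<otimes> y \<otimes> inv x \<otimes> y)"
    by (intro apart_cancel) auto
  from apart_sym[OF this] have a23: "apart M ?v2 ?v3" by (simp add: m_assoc inv_mult_group)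
  have V: "code ?V"
    using a12 a13 a23 v2 v3 y lens by (auto simp: code_def free_Cons)
  have V1': "map fst ?V1 = map ((\<otimes>) (x \<otimes> inv y)) (map fst ?V)"
    by (simp add: m_assoc)
  have "free (map fst ?V1)"
    unfolding V1' using V P(1) by (intro free_shift) (auto simp: code_def Mp_M)
  then have V1: "code ?V1" using x lens by (auto simp: code_def)
  obtain C where C: "code C" "wt q C = wt q ?V + (1 + q ^ 2 + q ^ 4) * wt q ?V1"
    using code_tower[OF V _ V1 V1' P(1,3)] v2(2) v3(2) P(2) D by fastforce
  have wts: "wt q ?V = 18 * q - 7" "wt q ?V1 = 18 * q - 7" by (simp_all add: q_powers)
  have "wt q C = 746 * q - 308"
    unfolding C(2) wts q_powers(3) using q_powers(1) by Groebner_Basis.algebra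
  then show ?thesis
    using C(1) q_bounds by (intro code_growth) auto
qed

text \<open>
  Here \<open>k = x y\<inverse> y\<inverse>\<close> is elliptic, and the words \<open>y\<close>, \<open>y y x\<inverse> y = k\<inverse> y\<close>,
  \<open>x y\<inverse> y\<inverse> x = k x\<close> and \<open>P = k y\<close> lie below the children \<open>k\<^sup>i (D y)\<close> for
  \<open>i = 0, -1, 2, 1\<close>, which are different as \<open>p > 3\<close>.
\<close>
lemma growth_height_double:
  assumes "ht x = 2 * ht y" "p > 3"
  shows "growth_rate G S \<ge> 1 / q"
proof -
  let ?v2 = "y \<otimes> (y \<otimes> (inv x \<otimes> y))" and ?v3 = "x \<otimes> (inv y \<otimes> (inv y \<otimes> x))"
  let ?V = "[(y, 1::nat), (?v2, 4), (?v3, 4)]"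
  let ?V1 = "[(x, 1::nat), (x \<otimes> (y \<otimes> (inv x \<otimes> y)), 4), (x \<otimes> (inv y \<otimes> ?v3), 6)]"
  have yy: "y \<otimes> y \<in> Mp" using Mp_mult2 y by auto
  define k where "k = x \<otimes> inv (y \<otimes> y)"
  have k [simp]: "k \<in> carrier G" by (simp add: k_def)
  have kH: "k \<in> H"
    unfolding k_def using x(1) yy assms by (intro M_ht_0 M_quotient) (auto simp: Mp_M)
  have pows: "k [^] (0::int) = \<one>" "k [^] (1::int) = k" "k [^] (2::int) = k \<otimes> k" "k [^] (-1::int) = inv k"
    using int_pow_mult[OF k, of 1 1] by (simp_all add: int_pow_neg)
  have Px: "x \<otimes> inv y = k \<otimes> y" by (simp add: k_def m_assoc inv_mult_group)
  have v3: "?v3 = k \<otimes> x" by (simp add: k_def m_assoc inv_mult_group)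
  have v2: "?v2 = inv k \<otimes> y" by (simp add: k_def m_assoc inv_mult_group)
  have ky: "D (k \<otimes> y) = D x" using P(2) by (simp add: Px)
  have kB: "k \<notin> B" using D_B[of k y] y ky D by (auto simp: Mp_M)
  have kx: "D (k \<otimes> x) = D (k [^] (2::int) \<otimes> y)"
  proof -
    have "D (k \<otimes> x) = D (k \<otimes> (k \<otimes> y))"
      using kH x y ky by (intro D_H_cong) (auto simp: Mp_M intro: M_mult H_subset_M)
    then show ?thesis by (simp add: pows m_assoc)
  qed
  have ne: "D (k [^] (i::int) \<otimes> y) \<noteq> D (k [^] (j::int) \<otimes> y)" if "i \<noteq> j" "\<bar>j - i\<bar> \<le> 3" for i j
  proof
    assume "D (k [^] i \<otimes> y) = D (k [^] j \<otimes> y)"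
    then have "int p dvd j - i" using kH kB y by (intro D_pow_eq[of k y]) (auto simp: Mp_M)
    then have "int p \<le> \<bar>j - i\<bar>" using that by (intro zdvd_imp_le) auto
    then show False using that assms(2) by linarith
  qed
  have mem: "?v2 \<in> Mp" "?v3 \<in> Mp"
    unfolding v2 v3 using kH x y by (auto intro: Mp_H subgroup.m_inv_closed[OF subgroup_H])
  have ne1: "D y \<noteq> D ?v2" "D y \<noteq> D ?v3" "D ?v2 \<noteq> D ?v3" "D ?v2 \<noteq> D x" "D ?v3 \<noteq> D x"
    unfolding v2 v3 kx ky[symmetric]
    using ne[of 0 "-1"] ne[of 0 2] ne[of "-1" 2] ne[of "-1" 1] ne[of 2 1] by (simp_all add: pows m_assoc)
  have V: "code ?V"
    using ne1 mem y lens by (auto simp: code_def free_Cons intro!: apart_Mp)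
  have V1': "map fst ?V1 = map ((\<otimes>) (x \<otimes> inv y)) (map fst ?V)"
    by (simp add: m_assoc)
  have "free (map fst ?V1)"
    unfolding V1' using V P(1) by (intro free_shift) (auto simp: code_def Mp_M)
  then have V1: "code ?V1" using x lens by (auto simp: code_def)
  obtain C where C: "code C" "wt q C = wt q ?V + (1 + q ^ 2 + q ^ 4) * wt q ?V1"
    using code_tower[OF V _ V1 V1' P(1,3)] ne1 P(2) D by fastforce
  have wts: "wt q ?V = 10 - 23 * q" "wt q ?V1 = 34 - 81 * q" by (simp_all add: q_powers)
  have "wt q C = 1382 - 3334 * q"
    unfolding C(2) wts q_powers(3) using q_powers(1) by Groebner_Basis.algebra
  then show ?thesis
    using C(1) q_bounds by (intro code_growth) auto
qed

text \<open>
  Below the child \<open>D x\<close>, the words \<open>x\<close>, \<open>x y x\<inverse> y\<close>, \<open>x y y x\<inverse> y\<close> and the translates of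
  any code of this kind by \<open>x y\<inverse>\<close> and \<open>x y\<inverse> y\<inverse>\<close> branch off from the axis of \<open>x\<close>
  in different places or directions.  Two rounds of this substitution, and \<open>y\<close> for the other
  child, give the required code.
\<close>
lemma growth_height_more_double:
  assumes h2: "ht x > 2 * ht y"
  shows "growth_rate G S \<ge> 1 / q"
proof -
  let ?F1 = "x \<otimes> (y \<otimes> inv x)" and ?F2 = "x \<otimes> (y \<otimes> (y \<otimes> inv x))"
  let ?E1 = "x \<otimes> inv y" and ?E2 = "x \<otimes> (inv y \<otimes> inv y)"
  let ?U0 = "[(x, 1::nat), (x \<otimes> (y \<otimes> (inv x \<otimes> y)), 4), (x \<otimes> (y \<otimes> (y \<otimes> (inv x \<otimes> y))), 5)]"
  have yy: "y \<otimes> y \<in> Mp" "D (y \<otimes> y) = D y" using Mp_mult2 y by auto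
  have E2: "?E2 \<in> Mp" "D ?E2 = D x"
    using Mp_quotient[OF x(1) Mp_M[OF yy(1)]] h2 by (simp_all add: inv_mult_group)
  have F1: "?F1 \<in> Mp" "D ?F1 = D x"
    using Mp_quotient[OF Mp_mult2(1)[OF x(1) y(1)] Mp_M[OF x(1)]] Mp_mult2(2)[OF x(1) y(1)] Mp_ht[OF y(1)]
    by (simp_all add: m_assoc)
  have F2: "?F2 \<in> Mp" "D ?F2 = D x"
    using Mp_quotient[OF Mp_mult2(1)[OF x(1) yy(1)] Mp_M[OF x(1)]] Mp_mult2(2)[OF x(1) yy(1)] Mp_ht[OF y(1)]
    by (simp_all add: m_assoc)
  have F1y: "?F1 \<otimes> y \<in> Mp" "D (?F1 \<otimes> y) = D x" and F2y: "?F2 \<otimes> y \<in> Mp" "D (?F2 \<otimes> y) = D x"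
    using Mp_mult2[OF F1(1) y(1)] Mp_mult2[OF F2(1) y(1)] F1 F2 by simp_all
  have x_F1: "apart M x (?F1 \<otimes> y)"
    using apart_cancel[OF _ _ _ apart_Mp[OF P(1) y(1)], of ?F1] P D by (simp add: m_assoc)
  have x_F2: "apart M x (?F2 \<otimes> y)"
    using apart_cancel[OF _ _ _ apart_Mp[OF E2(1) y(1)], of ?F2] E2 D by (simp add: m_assoc)
  have F1_F2: "apart M (?F1 \<otimes> y) (?F2 \<otimes> y)"
    using apart_cancel[OF _ _ _ apart_Mp[OF y(1) F1y(1)], of ?F1] F1y D y by (simp add: m_assoc)
  have x_E: "apart M x (?E1 \<otimes> u)" "apart M x (?E2 \<otimes> u)" if u: "u \<in> Mp" "D u = D x" for u
  proof -
    show "apart M x (?E1 \<otimes> u)"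
      using apart_cancel[OF _ _ _ apart_Mp[OF y(1) u(1)], of ?E1] u D by (simp add: m_assoc)
    show "apart M x (?E2 \<otimes> u)"
      using apart_cancel[OF _ _ _ apart_Mp[OF yy(1) u(1)], of ?E2] yy u D by (simp add: m_assoc)
  qed
  have E_E: "apart M (?E1 \<otimes> u) (?E2 \<otimes> u')" if u: "u \<in> Mp" "u' \<in> Mp" "D u' = D x" for u u'
    using apart_cancel[OF _ _ _ apart_Mp[OF Mp_mult2(1)[OF y(1) u(1)] u(2)], of ?E2]
      Mp_mult2(2)[OF y(1) u(1)] u D by (simp add: m_assoc)
  \<comment> \<open>Used for \<open>w = y\<^sup>i\<^sup>+\<^sup>j\<close>: with \<open>E\<^sub>i = x y\<^sup>-\<^sup>i\<close> and \<open>F\<^sub>j = x y\<^sup>j x\<inverse>\<close>, one has \<open>F\<^sub>j\<inverse> E\<^sub>i u = x w\<inverse> u\<close>.\<close>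
  have quot: "apart M (x \<otimes> (inv w \<otimes> u)) y" if "w \<in> Mp" "D w = D y" "u \<in> Mp" "D u = D x" for w u
    using that x y D p by (intro apart_quotient) auto
  have y3: "y \<otimes> (y \<otimes> y) \<in> Mp" "D (y \<otimes> (y \<otimes> y)) = D y"
    and y4: "y \<otimes> (y \<otimes> (y \<otimes> y)) \<in> Mp" "D (y \<otimes> (y \<otimes> (y \<otimes> y))) = D y"
    using Mp_mult2 y by auto
  have F_E: "apart M (F \<otimes> y) (E \<otimes> u)" if u: "u \<in> Mp" "D u = D x"
    and FE: "F \<in> {?F1, ?F2}" "E \<in> {?E1, ?E2}" for E F u
  proof -
    have "apart M (?F1 \<otimes> (x \<otimes> (inv (y \<otimes> y) \<otimes> u))) (?F1 \<otimes> y)"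
      "apart M (?F1 \<otimes> (x \<otimes> (inv (y \<otimes> (y \<otimes> y)) \<otimes> u))) (?F1 \<otimes> y)"
      "apart M (?F2 \<otimes> (x \<otimes> (inv (y \<otimes> (y \<otimes> y)) \<otimes> u))) (?F2 \<otimes> y)"
      "apart M (?F2 \<otimes> (x \<otimes> (inv (y \<otimes> (y \<otimes> (y \<otimes> y))) \<otimes> u))) (?F2 \<otimes> y)"
      using quot yy y3 y4 u by (intro apart_cancel; simp)+
    note this[THEN apart_sym]
    then show ?thesis
      using FE u by (auto simp: m_assoc inv_mult_group)
  qed
  have U0: "code ?U0"
    using x_F1 x_F2 F1_F2 F1y F2y x lens by (auto simp: code_def free_Cons m_assoc)
  have U0_D: "D c = D x" if "c \<in> fst ` set ?U0" for c
    using that F1y F2y by (auto simp: m_assoc)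
  define up where "up U = ?U0 @ shift ?E1 2 U @ shift ?E2 3 U" for U
  have E: "?E1 \<in> M" "len ?E1 2" "?E2 \<in> M" "len ?E2 3"
    using P E2 lens Mp_M by auto
  have up: "code (up U) \<and> (\<forall>c\<in>fst ` set (up U). D c = D x)"
    if U: "code U" "\<forall>c\<in>fst ` set U. D c = D x" for U
  proof
    define X where "X = fst ` set U"
    have Mp: "c \<in> Mp" "D c = D x" if "c \<in> X" for c
      using that U by (auto simp: code_def free_def X_def)
    have sh: "fst ` set (shift c n U) = (\<lambda>u. c \<otimes> u) ` X" for c n
      by (simp only: set_map[symmetric] fst_shift X_def)
    have F_set: "fst ` set ?U0 = {x, ?F1 \<otimes> y, ?F2 \<otimes> y}" by (simp add: m_assoc)
    have sep1: "apart M c d"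
      if "c \<in> fst ` set ?U0" "d \<in> fst ` set (shift ?E1 2 U) \<union> fst ` set (shift ?E2 3 U)" for c d
      using that x_E F_E Mp unfolding F_set sh by auto
    have sep2: "apart M c d" if "c \<in> fst ` set (shift ?E1 2 U)" "d \<in> fst ` set (shift ?E2 3 U)" for c d
      using that E_E Mp unfolding sh by auto
    show "code (up U)"
      unfolding up_def code_append
      using U0 U(1) E sep1 sep2 by (auto intro!: code_shift)
    show "\<forall>c\<in>fst ` set (up U). D c = D x"
    proof
      fix c assume "c \<in> fst ` set (up U)"
      then consider "c \<in> fst ` set ?U0" | u where "u \<in> X" "c = ?E1 \<otimes> u" | u where "u \<in> X" "c = ?E2 \<otimes> u"
        unfolding up_def set_append image_Un sh by blast
      then show "D c = D x"
      proof cases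
        case 1
        then show ?thesis by (rule U0_D)
      next
        case 2
        then show ?thesis using Mp_mult2(2)[OF P(1) Mp(1)] P(2) by simp
      next
        case 3
        then show ?thesis using Mp_mult2(2)[OF E2(1) Mp(1)] E2(2) by simp
      qed
    qed
  qed
  have U2: "code (up (up ?U0))" "\<And>c. c \<in> fst ` set (up (up ?U0)) \<Longrightarrow> D c = D x"
    using up[of "up ?U0"] up[of ?U0] U0 U0_D by blast+
  have "code ((y, 1) # up (up ?U0))"
  proof -
    have "apart M y c" if "c \<in> fst ` set (up (up ?U0))" for c
      using that U2 y D by (intro apart_Mp) (auto simp: code_def free_def)
    then have "code ([(y, 1)] @ up (up ?U0))"
      unfolding code_append using U2(1) y by (auto simp: code_def free_Cons)
    then show ?thesis by simp
  qed
  moreover have "wt q ((y, 1) # up (up ?U0)) = 1084 * q - 448"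
  proof -
    have U0_wt: "wt q ?U0 = 18 * q - 7" by (simp add: q_powers)
    have "wt q (up U) = 18 * q - 7 + (3 * q - 1) * wt q U" for U
      unfolding up_def wt_append wt_shift U0_wt q_powers by (simp add: algebra_simps)
    then have "wt q ((y, 1) # up (up ?U0)) =
        q + (18 * q - 7 + (3 * q - 1) * (18 * q - 7 + (3 * q - 1) * (18 * q - 7)))"
      using U0_wt by simp
    also have "\<dots> = 1084 * q - 448" using q_powers(1) by Groebner_Basis.algebra
    finally show ?thesis .
  qed
  ultimately show ?thesis
    using q_bounds by (intro code_growth) auto
qed

lemma growth_unequal_height:
  assumes "p > 3" shows "growth_rate G S \<ge> 1 + sqrt 2"
proof -
  have "1 / q = 1 + sqrt 2"
    using q_bounds by (simp add: q_def field_simps)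
  then show ?thesis
    using growth_height_less_double growth_height_double growth_height_more_double assms
    by (metis linorder_less_linear)
qed

end

end

section \<open>The polynomial \<open>T\<^sub>k\<close>\<close>

text \<open>
  The value of the generating function of the words \<open>a\<^sup>i x\<close> with \<open>|i| \<le> k\<close>.  The
  positive roots of \<open>T\<^sub>k\<close> are the reciprocals of the positive points where this function takes
  the value \<open>1\<close>.  There is only one such point, as the function is strictly increasing.
\<close>
definition recip_sum :: "nat \<Rightarrow> real \<Rightarrow> real" where
  "recip_sum k z = z + 2 * (\<Sum>j<k. z ^ (j + 2))"

lemma T_poly_recip:
  assumes "z > 0" shows "z ^ (k + 1) * T_poly k (1 / z) = 1 - recip_sum k z"
proof -
  have eq: "z ^ (k + 1) * (1 / z) ^ j = z ^ (k + 1 - j)" if "j \<le> k + 1" for j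
    using assms that by (simp add: power_diff power_divide)
  have pow: "z ^ (k + 1) * (1 / z) ^ (k + 1) = 1" "z ^ (k + 1) * (1 / z) ^ k = z"
    using eq[of "k + 1"] eq[of k] by auto
  have pow3: "z ^ (k + 1) * (1 / z) ^ j = z ^ ((k - Suc j) + 2)" if "j < k" for j
  proof -
    have "k + 1 - j = (k - Suc j) + 2" using that by simp
    then show ?thesis using eq[of j] that by simp
  qed
  have "z ^ (k + 1) * (\<Sum>j<k. (1 / z) ^ j) = (\<Sum>j<k. z ^ ((k - Suc j) + 2))"
    unfolding sum_distrib_left by (intro sum.cong pow3) auto
  also have "\<dots> = (\<Sum>j<k. z ^ (j + 2))"
    by (rule sum.nat_diff_reindex)
  finally have sum: "z ^ (k + 1) * (\<Sum>j<k. (1 / z) ^ j) = (\<Sum>j<k. z ^ (j + 2))" .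
  have "z ^ (k + 1) * T_poly k (1 / z) = z ^ (k + 1) * (1 / z) ^ (k + 1) - z ^ (k + 1) * (1 / z) ^ k
      - 2 * (z ^ (k + 1) * (\<Sum>j<k. (1 / z) ^ j))"
    unfolding T_poly_def by (simp only: right_diff_distrib mult.left_commute)
  then show ?thesis
    unfolding pow(1,2) sum recip_sum_def by simp
qed

lemma recip_sum_strict_mono:
  assumes "0 \<le> z" "z < w" shows "recip_sum k z < recip_sum k w"
proof -
  have "(\<Sum>j<k. z ^ (j + 2)) \<le> (\<Sum>j<k. w ^ (j + 2))"
    using assms by (intro sum_mono power_mono) auto
  then show ?thesis unfolding recip_sum_def using assms(2) by linarith
qed

lemma omega_root_recip:
  assumes "k \<ge> 1"
  shows "omega_root k > 0" "recip_sum k (1 / omega_root k) = 1"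
proof -
  have root_iff: "T_poly k r = 0 \<longleftrightarrow> recip_sum k (1 / r) = 1" if "r > 0" for r
    using T_poly_recip[of "1 / r" k] that by auto
  have "\<exists>z\<ge>0. z \<le> 1 \<and> recip_sum k z = 1"
  proof (rule IVT')
    show "recip_sum k 0 \<le> 1" by (simp add: recip_sum_def)
    show "1 \<le> recip_sum k 1" by (simp add: recip_sum_def)
    show "continuous_on {0..1} (recip_sum k)"
      unfolding recip_sum_def by (intro continuous_intros)
  qed simp
  then obtain z where z: "z \<ge> 0" "recip_sum k z = 1" by blast
  then have "z \<noteq> 0" by (auto simp: recip_sum_def)
  then have z0: "z > 0" using z by simp
  have "\<exists>!r. r > 0 \<and> T_poly k r = 0"
  proof (rule ex1I)
    show "1 / z > 0 \<and> T_poly k (1 / z) = 0" using z z0 root_iff by simp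
    fix r assume r: "r > 0 \<and> T_poly k r = 0"
    then have "recip_sum k (1 / r) = recip_sum k z" using root_iff[of r] z by simp
    then have "1 / r = z"
      using recip_sum_strict_mono[of z "1 / r" k] recip_sum_strict_mono[of "1 / r" z k] r z
      by (cases "1 / r" z rule: linorder_cases) auto
    then show "r = 1 / z" using r by auto
  qed
  from theI'[OF this] have "omega_root k > 0 \<and> T_poly k (omega_root k) = 0"
    unfolding omega_root_def .
  then show "omega_root k > 0" "recip_sum k (1 / omega_root k) = 1"
    using root_iff by auto
qed

lemma recip_sum_eq_1:
  assumes "k \<ge> 1" "z > 0" "recip_sum k z = 1"
  shows "z < 1" "z ^ 2 + 2 * z - 1 = 2 * z ^ (k + 2)"
proof -
  have "(\<Sum>j<k. z ^ (j + 2)) > 0"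
    using assms by (intro sum_pos) (auto simp: lessThan_empty_iff)
  then show "z < 1" using assms(3) by (simp add: recip_sum_def)
  have "(\<Sum>j<k. z ^ (j + 2)) = z ^ 2 * (\<Sum>j<k. z ^ j)"
    unfolding sum_distrib_left by (simp add: power2_eq_square mult.assoc)
  then have "(1 - z) * (\<Sum>j<k. z ^ (j + 2)) = z ^ 2 * ((1 - z) * (\<Sum>j<k. z ^ j))"
    by (simp only: mult.left_commute)
  also have "\<dots> = z ^ 2 * (1 - z ^ k)" by (simp only: one_diff_power_eq)
  finally have geo: "(1 - z) * (\<Sum>j<k. z ^ (j + 2)) = z ^ 2 - z ^ (k + 2)"
    by (simp add: algebra_simps power_add power2_eq_square)
  have "(1 - z) * recip_sum k z = (1 - z) * z + 2 * ((1 - z) * (\<Sum>j<k. z ^ (j + 2)))"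
    unfolding recip_sum_def by (simp only: distrib_left mult.left_commute)
  then have "1 - z = (1 - z) * z + 2 * (z ^ 2 - z ^ (k + 2))"
    unfolding geo assms(3) by simp
  then show "z ^ 2 + 2 * z - 1 = 2 * z ^ (k + 2)"
    by (simp add: algebra_simps power2_eq_square)
qed

text \<open>
  The lengths \<open>1, 1, 3, 3, \<dots>\<close> of the case of equal heights give a weight of at least \<open>1\<close> at the
  reciprocal of the root of \<open>T\<^sub>k\<close>.
\<close>
lemma odd_sum_ge_1:
  assumes "k \<ge> 1" "z > 0" "recip_sum k z = 1"
  shows "z + (\<Sum>j<k. z ^ (2 * j + 1)) + (\<Sum>j<k. z ^ (2 * j + 3)) \<ge> 1"
proof -
  note z = recip_sum_eq_1[OF assms]
  define s where "s = (\<Sum>j<k. (z ^ 2) ^ j)"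
  have s: "(1 - z ^ 2) * s = 1 - z ^ (2 * k)"
    unfolding s_def by (simp only: one_diff_power_eq[symmetric] power_mult)
  have sums: "(\<Sum>j<k. z ^ (2 * j + 1)) = z * s" "(\<Sum>j<k. z ^ (2 * j + 3)) = z ^ 3 * s"
  proof -
    have "z ^ (2 * j + 1) = z * (z ^ 2) ^ j" "z ^ (2 * j + 3) = z ^ 3 * (z ^ 2) ^ j" for j
      by (simp_all add: power_mult power_add power3_eq_cube)
    then show "(\<Sum>j<k. z ^ (2 * j + 1)) = z * s" "(\<Sum>j<k. z ^ (2 * j + 3)) = z ^ 3 * s"
      by (simp_all only: s_def sum_distrib_left)
  qed
  have "(1 - z ^ 2) * (z + z * s + z ^ 3 * s - 1) =
      (1 - z ^ 2) * (z - 1) + (z + z ^ 3) * ((1 - z ^ 2) * s)"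
    by (simp add: algebra_simps)
  also have "\<dots> = (z ^ 2 + 2 * z - 1) - z ^ (2 * k) * (z + z ^ 3)"
    unfolding s by (simp add: algebra_simps power2_eq_square power3_eq_cube)
  also have "\<dots> = 2 * z ^ (k + 2) - (z ^ (2 * k + 1) + z ^ (2 * k + 3))"
    unfolding z(2) by (simp add: algebra_simps power_add power3_eq_cube)
  also have "\<dots> \<ge> 0"
  proof -
    have "z ^ (2 * k + 1) \<le> z ^ (k + 2)" "z ^ (2 * k + 3) \<le> z ^ (k + 2)"
      using z(1) assms by (intro power_decreasing; simp)+
    then show ?thesis by linarith
  qed
  finally have "(1 - z ^ 2) * (z + z * s + z ^ 3 * s - 1) \<ge> 0" .
  moreover have "1 - z ^ 2 > 0" using z(1) assms(2) by (simp add: power_less_one_iff)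
  ultimately show ?thesis unfolding sums by (simp add: zero_le_mult_iff)
qed

lemma omega_root_le:
  assumes "k \<ge> 1" shows "omega_root k \<le> 1 + sqrt 2"
proof -
  define z where "z = 1 / omega_root k"
  note r = omega_root_recip[OF assms]
  have z0: "z > 0" using r by (simp add: z_def)
  have "z ^ 2 + 2 * z - 1 \<ge> 0"
    using recip_sum_eq_1(2)[OF assms z0] r z0 by (simp add: z_def)
  then have "(z + 1) ^ 2 \<ge> (sqrt 2) ^ 2" by (simp add: power2_eq_square algebra_simps)
  then have "z + 1 \<ge> sqrt 2" by (rule power2_le_imp_le) (use z0 in simp)
  then have "(1 + sqrt 2) * z \<ge> (1 + sqrt 2) * (sqrt 2 - 1)" by (intro mult_left_mono) auto
  then have "(1 + sqrt 2) * z \<ge> 1" by (simp add: algebra_simps)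
  then show ?thesis using r(1) by (simp add: z_def field_simps)
qed

section \<open>Growth of ascending HNN extensions\<close>

theorem (in ascending_hnn) growth_rate_bound:
  assumes S: "S \<in> fin_gen_sets G"
  shows "p = 2 \<Longrightarrow> growth_rate G S \<ge> (1 + sqrt 5) / 2"
    and "p = 2 * k + 1 \<Longrightarrow> growth_rate G S \<ge> omega_root k"
proof -
  from diverge[OF S] obtain g x where gc: "g \<in> common S" and x: "x \<in> pos S" "ht x > 0"
    and cases: "(\<exists>a\<in>pos S. inv g \<otimes> a \<otimes> g \<in> H - B) \<or>
     (\<exists>y\<in>pos S. ht y > 0 \<and> D (inv g \<otimes> y \<otimes> g) \<noteq> D (inv g \<otimes> x \<otimes> g))"
    by blast
  have gG: "g \<in> carrier G" using gc unfolding common_def by blast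
  interpret hnn_generators G H t ht p S g
    using S gG by unfold_locales
  have pos_G: "s \<in> carrier G" if "s \<in> pos S" for s
    using that S_closed unfolding pos_def by auto
  define x' where "x' = inv g \<otimes> x \<otimes> g"
  have letter: "inv g \<otimes> s \<otimes> g \<in> Mp" if "s \<in> pos S" "ht s > 0" for s
  proof (rule Mp_I)
    show "inv g \<otimes> s \<otimes> g \<in> M" using gc that(1) unfolding common_def by blast
    show "ht (inv g \<otimes> s \<otimes> g) > 0" using that pos_G gG by simp
  qed
  have x': "x' \<in> Mp" "len x' 1" "len (inv x') 1"
    unfolding x'_def by (rule letter[OF x] len_letter[OF x(1)])+
  consider (elliptic) a where "a \<in> H" "a \<notin> B" "len a 1" "len (inv a) 1"
    | (hyperbolic) y where "y \<in> Mp" "len y 1" "len (inv y) 1" "D x' \<noteq> D y"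
  proof -
    from cases show thesis
    proof
      assume "\<exists>a\<in>pos S. inv g \<otimes> a \<otimes> g \<in> H - B"
      then obtain a where a: "a \<in> pos S" "inv g \<otimes> a \<otimes> g \<in> H" "inv g \<otimes> a \<otimes> g \<notin> B" by blast
      show thesis by (rule elliptic[OF a(2,3) len_letter[OF a(1)]])
    next
      assume "\<exists>y\<in>pos S. ht y > 0 \<and> D (inv g \<otimes> y \<otimes> g) \<noteq> D (inv g \<otimes> x \<otimes> g)"
      then obtain y where y: "y \<in> pos S" "ht y > 0" "D (inv g \<otimes> y \<otimes> g) \<noteq> D x'"
        unfolding x'_def by blast
      show thesis
        by (rule hyperbolic[OF letter[OF y(1,2)] len_letter[OF y(1)] y(3)[symmetric]])
    qed
  qed
  note either = this
  show "growth_rate G S \<ge> (1 + sqrt 5) / 2" if p: "p = 2"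
  proof -
    define z where "z = (sqrt 5 - 1) / 2"
    have sqrt5: "2 < sqrt 5" "sqrt 5 < 3"
      by (auto intro: real_less_rsqrt real_less_lsqrt)
    have z: "z + z ^ 2 = 1" "0 < z" "z \<le> 1" "2 * z \<ge> 1"
      using sqrt5 by (auto simp: z_def power2_eq_square field_simps)
    have "1 / z = (1 + sqrt 5) / 2"
      using sqrt5 by (simp add: z_def field_simps)
    moreover from either have "growth_rate G S \<ge> 1 / z"
    proof cases
      case elliptic
      then show ?thesis using growth_elliptic_two[OF _ _ _ x'(1,2) p z(1-3)] by blast
    next
      case (hyperbolic y)
      show ?thesis by (rule growth_two_hyperbolic[OF x'(1,2) hyperbolic(1,2,4) z(4,3)])
    qed
    ultimately show ?thesis by simp
  qed
  show "growth_rate G S \<ge> omega_root k" if p: "p = 2 * k + 1"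
  proof -
    have k: "k \<ge> 1" using p prime_p by (cases k) auto
    define z where "z = 1 / omega_root k"
    note r = omega_root_recip[OF k]
    have z: "0 < z" "z < 1" "recip_sum k z = 1"
      using r recip_sum_eq_1(1)[OF k] by (auto simp: z_def)
    have *: "growth_rate G S \<ge> omega_root k" if "growth_rate G S \<ge> 1 / z"
      using that by (simp add: z_def)
    from either show ?thesis
    proof cases
      case elliptic
      then show ?thesis
        using growth_elliptic_odd[OF _ _ _ _ x'(1,2) p, of _ z] z
        by (intro *) (auto simp: recip_sum_def)
    next
      case (hyperbolic y)
      show ?thesis
      proof (cases "ht x' = ht y")
        case True
        then show ?thesis
          using growth_equal_height[OF x' hyperbolic(1-3) True hyperbolic(4) p odd_sum_ge_1[OF k z(1,3)]] z
          by (intro *) auto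
      next
        case False
        show ?thesis
        proof (cases "k = 1")
          case True
          have "(2 * z - 1) * (z + 1) = 0"
            using z(3) unfolding True by (simp add: recip_sum_def algebra_simps power2_eq_square)
          then have "2 * z \<ge> 1" using z(1) by auto
          then show ?thesis
            using growth_two_hyperbolic[OF x'(1,2) hyperbolic(1,2,4)] z by (intro *) auto
        next
          case k1: False
          then have p3: "p > 3" using p k by simp
          have "growth_rate G S \<ge> 1 + sqrt 2"
          proof (cases "ht y < ht x'")
            case True
            then show ?thesis
              using growth_unequal_height[OF x' hyperbolic(1-3) hyperbolic(4)] p3 by simp
          next
            case less: False
            then show ?thesis
              using growth_unequal_height[OF hyperbolic(1-3) x' hyperbolic(4)[symmetric]] p3 False by simp
          qed
          then show ?thesis using omega_root_le[OF k] by linarith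
        qed
      qed
    qed
  qed
qed

section \<open>Evaluating words in a group\<close>

text \<open>
  The value of a word under an assignment \<open>f\<close> of elements of \<open>K\<close> to the generators.
\<close>
definition eval_word :: "('k, 'm) monoid_scheme \<Rightarrow> ('s \<Rightarrow> 'k) \<Rightarrow> 's gword \<Rightarrow> 'k" where
  "eval_word K f w = foldr (\<lambda>(s, b) a. (if b then f s else m_inv K (f s)) \<otimes>\<^bsub>K\<^esub> a) w \<one>\<^bsub>K\<^esub>"

lemma eval_word_Nil [simp]: "eval_word K f [] = \<one>\<^bsub>K\<^esub>"
  by (simp add: eval_word_def)

lemma eval_word_Cons [simp]:
  "eval_word K f ((s, b) # w) = (if b then f s else m_inv K (f s)) \<otimes>\<^bsub>K\<^esub> eval_word K f w"
  by (simp add: eval_word_def)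

context group
begin

context
  fixes X :: "'s set" and f :: "'s \<Rightarrow> 'a"
  assumes f: "\<And>s. s \<in> X \<Longrightarrow> f s \<in> carrier G"
begin

lemma eval_word_closed: "w \<in> words_over X \<Longrightarrow> eval_word G f w \<in> carrier G"
  by (induction w) (auto simp: f)

lemma eval_word_append:
  "u \<in> words_over X \<Longrightarrow> v \<in> words_over X \<Longrightarrow>
    eval_word G f (u @ v) = eval_word G f u \<otimes> eval_word G f v"
  by (induction u) (auto simp: f eval_word_closed m_assoc)

lemma eval_word_inv:
  "w \<in> words_over X \<Longrightarrow> eval_word G f (inv_word w) = inv (eval_word G f w)"
proof (induction w)
  case (Cons x w)
  obtain s b where x: "x = (s, b)" by (cases x)
  have fs: "f s \<in> carrier G" using Cons.prems x f by simp
  have "inv_word (x # w) = inv_word w @ [(s, \<not> b)]" by (simp add: inv_word_def x)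
  then have "eval_word G f (inv_word (x # w)) = inv (eval_word G f w) \<otimes> eval_word G f [(s, \<not> b)]"
    using Cons x by (simp add: eval_word_append inv_word_in_words_over)
  then show ?case
    using Cons.prems x fs by (simp add: inv_mult_group eval_word_closed)
qed (simp add: inv_word_def)

lemma eval_word_pres_eq:
  assumes "pres_eq X R u v" "\<And>r. r \<in> R \<Longrightarrow> r \<in> words_over X \<Longrightarrow> eval_word G f r = \<one>"
  shows "eval_word G f u = eval_word G f v"
  using assms(1)
proof (induction rule: pres_eq.induct)
  case (cancel u v s b)
  have "eval_word G f [(s, b), (s, \<not> b)] = \<one>" using cancel by (simp add: f)
  moreover have "eval_word G f (u @ [(s, b), (s, \<not> b)] @ v) =
      eval_word G f u \<otimes> (eval_word G f [(s, b), (s, \<not> b)] \<otimes> eval_word G f v)"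
    using cancel by (subst eval_word_append, simp, simp, subst eval_word_append) auto
  ultimately show ?case
    using cancel by (simp add: eval_word_append eval_word_closed)
next
  case (relator u v r)
  then show ?case using assms(2) by (simp add: eval_word_append eval_word_closed)
qed auto

end

end

section \<open>The presentation of the HNN extension\<close>

lemma embed_word_words_over [simp]:
  "embed_word w \<in> words_over (insert None (Some ` S)) \<longleftrightarrow> w \<in> words_over S"
  by (induction w) (auto simp: embed_word_def)

lemma embed_word_append [simp]: "embed_word (u @ v) = embed_word u @ embed_word v"
  by (simp add: embed_word_def)

lemma embed_word_Nil [simp]: "embed_word [] = []"
  by (simp add: embed_word_def)

lemma embed_word_inv: "embed_word (inv_word w) = inv_word (embed_word w)"
  by (auto simp: embed_word_def inv_word_def rev_map)

text \<open>
  The data of the HNN extension, with \<open>H\<close> given by a presentation and \<open>\<theta>\<close> defined on all of \<open>H\<close>.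
\<close>
locale hnn_presentation = group H for H :: "('h, 'm) monoid_scheme" (structure) +
  fixes B :: "'h set" and \<theta> :: "'h \<Rightarrow> 'h" and p :: nat
    and S :: "'s set" and R :: "'s gword set" and \<phi> :: "'s gword set \<Rightarrow> 'h"
  assumes prime_p: "prime p"
    and normal_B: "B \<lhd> H"
    and index_B: "card (rcosets B) = p"
    and iso_\<theta>: "\<theta> \<in> iso H (H\<lparr>carrier := B\<rparr>)"
    and presentation: "is_presentation S R \<phi> H"
begin

interpretation normal B H by (rule normal_B)

text \<open>
  The generators \<open>X\<close> and relators \<open>Q\<close> of the HNN extension \<open>G\<close>, the element \<open>cls w\<close> of \<open>G\<close>
  represented by a word over \<open>X\<close>, and the element \<open>val w\<close> of \<open>H\<close> represented by a word over
  \<open>S\<close>.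
\<close>
definition X where "X = insert None (Some ` S)"
definition Q where "Q = embed_word ` R \<union> hnn_relators S R \<phi> (carrier H) \<theta>"
definition G where "G = presented_group X Q"
definition cls where "cls w = word_class X Q w"
definition val where "val w = \<phi> (word_class S R w)"

sublocale G: group G
  unfolding G_def by (rule group_presented_group)

lemma G_eq: "G = hnn_extension S R \<phi> (carrier H) \<theta>"
  by (simp add: G_def hnn_extension_def X_def Q_def)

lemma X_words [simp]: "embed_word w \<in> words_over X \<longleftrightarrow> w \<in> words_over S"
  unfolding X_def by simp

lemma None_X [simp]: "None \<in> X" by (simp add: X_def)

lemma cls_closed [simp]: "w \<in> words_over X \<Longrightarrow> cls w \<in> carrier G"
  by (simp add: cls_def G_def carrier_presented_group)

lemma carrier_cls: "g \<in> carrier G \<Longrightarrow> \<exists>w\<in>words_over X. g = cls w"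
  by (auto simp: cls_def G_def carrier_presented_group)

lemma cls_eq_iff: "u \<in> words_over X \<Longrightarrow> v \<in> words_over X \<Longrightarrow> cls u = cls v \<longleftrightarrow> pres_eq X Q u v"
  by (simp add: cls_def word_class_eq_iff)

lemma cls_append: "u \<in> words_over X \<Longrightarrow> v \<in> words_over X \<Longrightarrow> cls (u @ v) = cls u \<otimes>\<^bsub>G\<^esub> cls v"
  by (simp add: cls_def G_def mult_presented_group)

lemma cls_Nil: "cls [] = \<one>\<^bsub>G\<^esub>"
  by (simp add: cls_def G_def one_presented_group)

lemma cls_inv: "w \<in> words_over X \<Longrightarrow> cls (inv_word w) = inv\<^bsub>G\<^esub> cls w"
proof -
  assume w: "w \<in> words_over X"
  have "cls (inv_word w) \<otimes>\<^bsub>G\<^esub> cls w = cls []"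
    using w pres_eq_inv_word[OF w, of Q]
    by (simp add: cls_append[symmetric] inv_word_in_words_over cls_eq_iff)
  then show ?thesis
    using w by (intro G.inv_equality[symmetric]) (simp_all add: cls_Nil inv_word_in_words_over)
qed

lemma phi: "\<phi> \<in> hom (presented_group S R) H" "bij_betw \<phi> (carrier (presented_group S R)) (carrier H)"
  using presentation by (auto simp: is_presentation_def iso_def)

lemma R_words: "r \<in> R \<Longrightarrow> r \<in> words_over S"
  using presentation by (auto simp: is_presentation_def)

lemma class_closed: "w \<in> words_over S \<Longrightarrow> word_class S R w \<in> carrier (presented_group S R)"
  by (simp add: carrier_presented_group)

lemma val_closed [simp]: "w \<in> words_over S \<Longrightarrow> val w \<in> carrier H"
  unfolding val_def using hom_in_carrier[OF phi(1) class_closed] by simp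

lemma val_append: "u \<in> words_over S \<Longrightarrow> v \<in> words_over S \<Longrightarrow> val (u @ v) = val u \<otimes> val v"
  unfolding val_def
  using hom_mult[OF phi(1) class_closed class_closed] by (simp add: mult_presented_group)

lemma val_eq_iff: "u \<in> words_over S \<Longrightarrow> v \<in> words_over S \<Longrightarrow> val u = val v \<longleftrightarrow> pres_eq S R u v"
  unfolding val_def word_class_eq_iff[symmetric]
  using phi(2) class_closed by (auto simp: bij_betw_def dest: inj_onD)

lemma val_surj: "h \<in> carrier H \<Longrightarrow> \<exists>w\<in>words_over S. val w = h"
  using phi(2) by (force simp: bij_betw_def carrier_presented_group val_def)

lemma val_Nil: "val [] = \<one>"
  using val_append[of "[]" "[]"] val_closed[of "[]"] by simp

lemma val_inv: "w \<in> words_over S \<Longrightarrow> val (inv_word w) = inv (val w)"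
proof -
  assume w: "w \<in> words_over S"
  have "val (inv_word w) \<otimes> val w = val []"
    using w pres_eq_inv_word[OF w, of R]
    by (simp add: val_append[symmetric] inv_word_in_words_over val_eq_iff)
  then show ?thesis
    using w by (intro inv_equality[symmetric]) (simp_all add: val_Nil inv_word_in_words_over)
qed

lemma theta:
  "a \<in> carrier H \<Longrightarrow> \<theta> a \<in> B"
  "a \<in> carrier H \<Longrightarrow> b \<in> carrier H \<Longrightarrow> \<theta> (a \<otimes> b) = \<theta> a \<otimes> \<theta> b"
  "a \<in> carrier H \<Longrightarrow> b \<in> carrier H \<Longrightarrow> \<theta> a = \<theta> b \<Longrightarrow> a = b"
  "b \<in> B \<Longrightarrow> \<exists>a\<in>carrier H. \<theta> a = b"
  using iso_\<theta> by (auto simp: iso_def bij_betw_def hom_def Pi_def dest: inj_onD)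

lemma theta_closed [simp]: "a \<in> carrier H \<Longrightarrow> \<theta> a \<in> carrier H"
  by (rule mem_carrier[OF theta(1)])

lemma pow_p_in_B:
  assumes "h \<in> carrier H" shows "h [^] p \<in> B"
proof -
  have "order (H Mod B) = p" using index_B by (simp add: order_def FactGroup_def)
  then have "(B #> h) [^]\<^bsub>H Mod B\<^esub> p = B"
    using group.pow_order_eq_1[OF factorgroup_is_group, of "B #> h"] assms
    by (auto simp: carrier_FactGroup)
  then have "B #> (h [^] p) = B" using FactGroup_pow assms by metis
  then show ?thesis using rcos_self[OF nat_pow_closed[OF assms, of p] is_subgroup] by simp
qed

lemma B_proper: "\<exists>h\<in>carrier H. h \<notin> B"
proof (rule ccontr)
  assume "\<not> ?thesis"
  then have "B #> h = B" if "h \<in> carrier H" for h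
    using that coset_join2[OF _ is_subgroup] by blast
  then have "rcosets B = {B}" by (auto simp: RCOSETS_def)
  then show False using index_B prime_p by auto
qed

section \<open>The base group embeds in the HNN extension\<close>

text \<open>
  Left multiplication makes \<open>H \<times> \<nat>\<close> a free \<open>H\<close>-set with infinitely many orbits, and so does
  left multiplication twisted by \<open>\<theta>\<close>, since \<open>B\<close> has finite index.  The bijection \<open>\<tau>\<close> below
  intertwines the two actions and extends the action of \<open>H\<close> to the HNN extension.
\<close>

text \<open>
  Representatives of the \<open>p\<close> right cosets of \<open>B\<close>, numbered from \<open>0\<close>.
\<close>
definition rep :: "nat \<Rightarrow> 'h" where
  "rep = (SOME \<rho>. (\<forall>j<p. \<rho> j \<in> carrier H) \<and> bij_betw (\<lambda>j. B #> \<rho> j) {0..<p} (rcosets B))"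

lemma rep: "j < p \<Longrightarrow> rep j \<in> carrier H" "bij_betw (\<lambda>j. B #> rep j) {0..<p} (rcosets B)"
proof -
  have "finite (rcosets B)"
    using index_B prime_p by (metis card.infinite not_prime_0)
  then obtain c where c: "bij_betw c {0..<p} (rcosets B)"
    using ex_bij_betw_nat_finite index_B by blast
  have "\<exists>a\<in>carrier H. c j = B #> a" if "j < p" for j
  proof -
    have "c j \<in> rcosets B" using c that by (auto simp: bij_betw_def)
    then show ?thesis by (auto simp: RCOSETS_def)
  qed
  then obtain \<rho> where \<rho>: "\<And>j. j < p \<Longrightarrow> \<rho> j \<in> carrier H \<and> c j = B #> \<rho> j" by metis
  have "bij_betw (\<lambda>j. B #> \<rho> j) {0..<p} (rcosets B)"
    using c \<rho> by (subst bij_betw_cong[of _ _ c]) auto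
  then have "\<exists>\<rho>. (\<forall>j<p. \<rho> j \<in> carrier H) \<and> bij_betw (\<lambda>j. B #> \<rho> j) {0..<p} (rcosets B)"
    using \<rho> by blast
  from someI_ex[OF this] show "j < p \<Longrightarrow> rep j \<in> carrier H" "bij_betw (\<lambda>j. B #> rep j) {0..<p} (rcosets B)"
    unfolding rep_def by blast+
qed

text \<open>
  The set \<open>H \<times> \<nat>\<close>, left multiplication \<open>L h\<close> on it, and the bijection \<open>\<tau>\<close>.
\<close>
definition Y :: "('h \<times> nat) set" where "Y = carrier H \<times> UNIV"
definition L :: "'h \<Rightarrow> 'h \<times> nat \<Rightarrow> 'h \<times> nat" where "L h = (\<lambda>(g, i)\<in>Y. (h \<otimes> g, i))"
definition \<tau> :: "'h \<times> nat \<Rightarrow> 'h \<times> nat" where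
  "\<tau> = (\<lambda>(g, i)\<in>Y. (\<theta> g \<otimes> rep (i mod p), i div p))"

lemma p_pos: "p > 0" using prime_p by (simp add: prime_gt_0_nat)

lemma tau_Bij: "\<tau> \<in> Bij Y"
proof -
  have "bij_betw \<tau> Y Y"
  proof (rule bij_betwI')
    fix u v assume uv: "u \<in> Y" "v \<in> Y"
    obtain g i h j where eq: "u = (g, i)" "v = (h, j)" by (cases u, cases v)
    have gh: "g \<in> carrier H" "h \<in> carrier H" using uv eq by (auto simp: Y_def)
    show "\<tau> u = \<tau> v \<longleftrightarrow> u = v"
    proof
      assume "\<tau> u = \<tau> v"
      then have *: "\<theta> g \<otimes> rep (i mod p) = \<theta> h \<otimes> rep (j mod p)" "i div p = j div p"
        using uv unfolding eq \<tau>_def by auto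
      have mem: "\<theta> k \<otimes> rep (l mod p) \<in> B #> rep (l mod p)" if "k \<in> carrier H" for k l
        using that theta(1) by (auto simp: r_coset_def)
      have lt: "i mod p < p" "j mod p < p" using p_pos by auto
      have "B #> rep (i mod p) = B #> rep (j mod p)"
        using mem[OF gh(1), of i] mem[OF gh(2), of j] lt rep(1) is_subgroup *(1)
        by (metis repr_independence)
      then have ij: "i mod p = j mod p"
        using rep(2) lt by (auto simp: bij_betw_def inj_on_def)
      then have "i = j" using *(2) by (metis mult_div_mod_eq)
      moreover have "\<theta> g = \<theta> h" using * ij gh lt rep(1) by simp
      ultimately show "u = v" using theta(3) gh eq by auto
    qed simp
  next
    fix u assume "u \<in> Y"
    then show "\<tau> u \<in> Y" using p_pos rep(1) by (auto simp: Y_def \<tau>_def)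
  next
    fix v assume "v \<in> Y"
    then obtain g q where v: "v = (g, q)" "g \<in> carrier H" by (auto simp: Y_def)
    have "B #> g \<in> rcosets B" using v by (auto simp: RCOSETS_def)
    then obtain j where j: "j < p" "B #> g = B #> rep j"
      unfolding bij_betw_imp_surj_on[OF rep(2), symmetric] by auto
    have "g \<in> B #> rep j" using rcos_self[OF v(2) is_subgroup] j by simp
    then obtain b where b: "b \<in> B" "g = b \<otimes> rep j" by (auto simp: r_coset_def)
    obtain h where h: "h \<in> carrier H" "\<theta> h = b" using theta(4) b by blast
    have "\<tau> (h, j + p * q) = v" using h b j v by (simp add: \<tau>_def Y_def)
    then show "\<exists>u\<in>Y. v = \<tau> u" using h by (intro bexI[of _ "(h, j + p * q)"]) (auto simp: Y_def)
  qed
  then show ?thesis by (simp add: Bij_def \<tau>_def)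
qed

lemma L_Bij:
  assumes "h \<in> carrier H" shows "L h \<in> Bij Y"
proof -
  have "bij_betw (L h) Y Y"
    using assms
    by (intro bij_betw_byWitness[where f' = "L (inv h)"]) (auto simp: L_def Y_def)
  then show ?thesis by (simp add: Bij_def L_def)
qed

lemma L_mult:
  assumes "h \<in> carrier H" "k \<in> carrier H"
  shows "L (h \<otimes> k) = L h \<otimes>\<^bsub>BijGroup Y\<^esub> L k"
proof -
  have "L (h \<otimes> k) y = compose Y (L h) (L k) y" for y
    using assms by (cases y; cases "y \<in> Y") (auto simp: L_def compose_def Y_def m_assoc)
  then have "L (h \<otimes> k) = compose Y (L h) (L k)" by (rule ext)
  then show ?thesis using assms[THEN L_Bij] by (simp add: BijGroup_def)
qed

lemma tau_L:
  assumes "h \<in> carrier H"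
  shows "\<tau> \<otimes>\<^bsub>BijGroup Y\<^esub> L h = L (\<theta> h) \<otimes>\<^bsub>BijGroup Y\<^esub> \<tau>"
proof -
  have "compose Y \<tau> (L h) y = compose Y (L (\<theta> h)) \<tau> y" for y
    using assms rep(1)[of "snd y mod p"] p_pos
    by (cases y; cases "y \<in> Y") (auto simp: L_def \<tau>_def compose_def Y_def m_assoc theta(2))
  then have "compose Y \<tau> (L h) = compose Y (L (\<theta> h)) \<tau>" by (rule ext)
  then show ?thesis
    using L_Bij[OF assms] L_Bij[OF theta_closed[OF assms]] tau_Bij by (simp add: BijGroup_def)
qed

text \<open>
  The assignment of permutations of \<open>H \<times> \<nat>\<close> to the generators.
\<close>
definition act :: "'s option \<Rightarrow> 'h \<times> nat \<Rightarrow> 'h \<times> nat" where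
  "act x = (case x of None \<Rightarrow> \<tau> | Some s \<Rightarrow> L (val [(s, True)]))"

lemma act_simps [simp]: "act None = \<tau>" "act (Some s) = L (val [(s, True)])"
  by (simp_all add: act_def)

text \<open>
  The relators act trivially on \<open>H \<times> \<nat>\<close>, so the action of a word over \<open>S\<close> depends only on its
  class in \<open>G\<close>.  But it is left multiplication by its value in \<open>H\<close>.
\<close>
lemma embed_inj:
  assumes "u \<in> words_over S" "v \<in> words_over S" "cls (embed_word u) = cls (embed_word v)"
  shows "val u = val v"
proof -
  let ?K = "BijGroup Y"
  interpret K: group ?K by (rule group_BijGroup)
  have carrier_K: "carrier ?K = Bij Y" by (simp add: BijGroup_def)
  have K_mem: "\<tau> \<in> carrier ?K" "h \<in> carrier H \<Longrightarrow> L h \<in> carrier ?K" for h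
    using tau_Bij L_Bij by (simp_all add: carrier_K)
  have act: "act x \<in> carrier ?K" if "x \<in> X" for x
    using that tau_Bij L_Bij by (auto simp: carrier_K X_def)
  have L_one: "L \<one> = \<one>\<^bsub>?K\<^esub>"
    by (auto simp: L_def BijGroup_def Y_def fun_eq_iff)
  have L_inv: "L (inv h) = inv\<^bsub>?K\<^esub> (L h)" if "h \<in> carrier H" for h
    using that L_mult[of "inv h" h] L_Bij
    by (intro K.inv_equality[symmetric]) (auto simp: carrier_K L_one)
  have eval_embed: "eval_word ?K act (embed_word w) = L (val w)" if "w \<in> words_over S" for w
    using that
  proof (induction w)
    case (Cons x w)
    obtain s b where x: "x = (s, b)" by (cases x)
    have s: "s \<in> S" and w: "w \<in> words_over S" using Cons.prems x by auto
    have val_x: "val [(s, b)] = (if b then val [(s, True)] else inv (val [(s, True)]))"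
      using val_inv[of "[(s, True)]"] s by (simp add: inv_word_def)
    have "val (x # w) = val [(s, b)] \<otimes> val w"
      using val_append[of "[(s, b)]" w] s w x by simp
    moreover have "eval_word ?K act (embed_word (x # w)) = L (val [(s, b)]) \<otimes>\<^bsub>?K\<^esub> L (val w)"
    proof -
      have "embed_word (x # w) = (Some s, b) # embed_word w" by (simp add: embed_word_def x)
      then show ?thesis using Cons.IH[OF w] s L_inv val_x by simp
    qed
    ultimately show ?case using s w by (simp add: L_mult)
  qed (simp add: val_Nil L_one)
  have "eval_word ?K act r = \<one>\<^bsub>?K\<^esub>" if r: "r \<in> Q" "r \<in> words_over X" for r
  proof -
    from r(1) consider r' where "r' \<in> R" "r = embed_word r'"
      | w w' where "w \<in> words_over S" "w' \<in> words_over S" "val w' = \<theta> (val w)"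
        "r = [(None, True)] @ embed_word w @ [(None, False)] @ inv_word (embed_word w')"
      unfolding Q_def hnn_relators_def val_def by blast
    then show ?thesis
    proof cases
      case (1 r')
      have "pres_eq S R r' []"
        using pres_eq.relator[of "[]" S "[]" r' R] 1 R_words by simp
      then have "val r' = val []" using 1 R_words by (simp add: val_eq_iff)
      then show ?thesis using 1 eval_embed R_words by (simp add: val_Nil L_one)
    next
      case (2 w w')
      have "eval_word ?K act r =
          \<tau> \<otimes>\<^bsub>?K\<^esub> (L (val w) \<otimes>\<^bsub>?K\<^esub> (inv\<^bsub>?K\<^esub> \<tau> \<otimes>\<^bsub>?K\<^esub> inv\<^bsub>?K\<^esub> L (\<theta> (val w))))"
        using 2 K.eval_word_append[of X act, OF act] K.eval_word_inv[of X act, OF act] eval_embed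
        by (simp add: inv_word_in_words_over)
      also have "\<dots> = (\<tau> \<otimes>\<^bsub>?K\<^esub> L (val w)) \<otimes>\<^bsub>?K\<^esub> inv\<^bsub>?K\<^esub> (L (\<theta> (val w)) \<otimes>\<^bsub>?K\<^esub> \<tau>)"
        using 2 K_mem by (simp add: K.m_assoc K.inv_mult_group)
      also have "\<dots> = \<one>\<^bsub>?K\<^esub>"
        using 2 K_mem tau_L by simp
      finally show ?thesis .
    qed
  qed
  moreover have "pres_eq X Q (embed_word u) (embed_word v)"
    using assms by (simp add: cls_eq_iff)
  ultimately have "eval_word ?K act (embed_word u) = eval_word ?K act (embed_word v)"
    using K.eval_word_pres_eq[of X act, OF act] by blast
  then have "L (val u) = L (val v)" using eval_embed assms by simp
  then have "L (val u) (\<one>, 0) = L (val v) (\<one>, 0)" by simp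
  then show ?thesis using assms by (simp add: L_def Y_def)
qed

section \<open>The structure of the HNN extension\<close>

text \<open>
  The homomorphism from \<open>H\<close> to \<open>G\<close>.  The choice of the word does not matter, by lemma \<open>emb_val\<close>.
\<close>
definition emb :: "'h \<Rightarrow> 's option gword set" where
  "emb h = cls (embed_word (SOME w. w \<in> words_over S \<and> val w = h))"

lemma emb_val:
  assumes w: "w \<in> words_over S" shows "emb (val w) = cls (embed_word w)"
proof -
  define v where "v = (SOME v. v \<in> words_over S \<and> val v = val w)"
  have v: "v \<in> words_over S" "val v = val w"
    using someI_ex[of "\<lambda>v. v \<in> words_over S \<and> val v = val w"] w unfolding v_def by blast+
  have "pres_eq X Q (embed_word a) (embed_word b)" if "pres_eq S R a b" for a b
    using that
  proof (induction rule: pres_eq.induct)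
    case (cancel u v s b)
    have "pres_eq X Q (embed_word u @ [(Some s, b), (Some s, \<not> b)] @ embed_word v) (embed_word u @ embed_word v)"
      using cancel by (intro pres_eq.cancel) (auto simp: X_def)
    then show ?case by (simp add: embed_word_def)
  next
    case (relator u v r)
    have "pres_eq X Q (embed_word u @ embed_word r @ embed_word v) (embed_word u @ embed_word v)"
      using relator by (intro pres_eq.relator) (auto simp: Q_def)
    then show ?case by simp
  next
    case (trans u v w)
    then show ?case by (blast intro: pres_eq.trans)
  qed (auto intro: pres_eq.refl pres_eq.sym)
  then have "cls (embed_word v) = cls (embed_word w)"
    using v w val_eq_iff[of v w] by (simp add: cls_eq_iff)
  then show ?thesis unfolding emb_def v_def .
qed

lemma emb_hom: "emb \<in> hom H G"
proof (rule homI)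
  fix h assume "h \<in> carrier H"
  then obtain w where "w \<in> words_over S" "val w = h" using val_surj by blast
  then show "emb h \<in> carrier G" using emb_val[of w] by simp
next
  fix h k assume "h \<in> carrier H" "k \<in> carrier H"
  then obtain v w where "v \<in> words_over S" "val v = h" "w \<in> words_over S" "val w = k"
    using val_surj by meson
  then show "emb (h \<otimes> k) = emb h \<otimes>\<^bsub>G\<^esub> emb k"
    using emb_val[of v] emb_val[of w] emb_val[of "v @ w"] by (simp add: val_append cls_append)
qed

sublocale emb: group_hom H G emb
  using emb_hom by unfold_locales

lemma emb_inj: "h \<in> carrier H \<Longrightarrow> k \<in> carrier H \<Longrightarrow> emb h = emb k \<Longrightarrow> h = k"
  using val_surj emb_val embed_inj by metis

text \<open>
  The stable letter.
\<close>
definition stable where "stable = cls [(None, True)]"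

lemma stable_closed [simp]: "stable \<in> carrier G"
  by (simp add: stable_def)

lemma inv_stable: "inv\<^bsub>G\<^esub> stable = cls [(None, False)]"
  using cls_inv[of "[(None, True)]"] by (simp add: stable_def inv_word_def)

lemma stable_conj:
  assumes "h \<in> carrier H"
  shows "stable \<otimes>\<^bsub>G\<^esub> emb h \<otimes>\<^bsub>G\<^esub> inv\<^bsub>G\<^esub> stable = emb (\<theta> h)"
proof -
  obtain w where w: "w \<in> words_over S" "val w = h" using val_surj assms by blast
  obtain w' where w': "w' \<in> words_over S" "val w' = \<theta> h" using val_surj[OF theta_closed[OF assms]] by blast
  have emb_w: "emb h = cls (embed_word w)" "emb (\<theta> h) = cls (embed_word w')"
    using emb_val w w' by metis+
  let ?r = "[(None, True)] @ embed_word w @ [(None, False)] @ inv_word (embed_word w')"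
  have r: "?r \<in> Q" "?r \<in> words_over X"
    using w w' assms by (auto simp: Q_def hnn_relators_def val_def inv_word_in_words_over)
  have "cls ?r = cls []"
    using pres_eq.relator[of "[]" X "[]" ?r Q] r by (simp only: cls_eq_iff words_over_Nil append_Nil append_Nil2)
  moreover have "cls ?r = stable \<otimes>\<^bsub>G\<^esub> (emb h \<otimes>\<^bsub>G\<^esub> (inv\<^bsub>G\<^esub> stable \<otimes>\<^bsub>G\<^esub> inv\<^bsub>G\<^esub> emb (\<theta> h)))"
    unfolding emb_w inv_stable unfolding stable_def using w(1) w'(1)
    by (simp only: cls_append cls_inv words_over_append words_over_Cons fst_conv None_X
        X_words inv_word_in_words_over words_over_Nil simp_thms)
  ultimately have "stable \<otimes>\<^bsub>G\<^esub> emb h \<otimes>\<^bsub>G\<^esub> inv\<^bsub>G\<^esub> stable \<otimes>\<^bsub>G\<^esub> inv\<^bsub>G\<^esub> emb (\<theta> h) = \<one>\<^bsub>G\<^esub>"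
    using assms by (simp add: G.m_assoc cls_Nil)
  then show ?thesis
    using assms by (metis G.inv_solve_right' G.l_one G.m_closed G.inv_closed G.one_closed emb.hom_closed stable_closed theta_closed)
qed

text \<open>
  The exponent sum of the stable letter in a word representing \<open>g\<close>.
\<close>
definition height :: "'s option gword set \<Rightarrow> int" where
  "height g = eval_word integer_group (\<lambda>x. if x = None then 1 else 0) (SOME w. w \<in> words_over X \<and> g = cls w)"

lemma height_cls:
  assumes w: "w \<in> words_over X"
  shows "height (cls w) = eval_word integer_group (\<lambda>x. if x = None then 1 else 0) w"
proof -
  let ?f = "\<lambda>x :: 's option. if x = None then 1 else (0 :: int)"
  interpret Z: group integer_group by simp
  define v where "v = (SOME v. v \<in> words_over X \<and> cls w = cls v)"
  have v: "v \<in> words_over X" "cls w = cls v"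
    using someI_ex[of "\<lambda>v. v \<in> words_over X \<and> cls w = cls v"] w unfolding v_def by blast+
  have append: "eval_word integer_group ?f (u @ u') = eval_word integer_group ?f u + eval_word integer_group ?f u'"
    if "u \<in> words_over X" "u' \<in> words_over X" for u u'
    using Z.eval_word_append[of X ?f u u'] that by simp
  have embed: "eval_word integer_group ?f (embed_word u) = 0" for u
    by (induction u) (auto simp: embed_word_def)
  have rel: "eval_word integer_group ?f r = \<one>\<^bsub>integer_group\<^esub>" if r: "r \<in> Q" "r \<in> words_over X" for r
  proof -
    from r(1) consider u where "r = embed_word u"
      | u u' where "u \<in> words_over S" "u' \<in> words_over S"
        "r = (None, True) # (embed_word u @ ((None, False) # embed_word (inv_word u')))"
      unfolding Q_def hnn_relators_def embed_word_inv by auto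
    then show ?thesis
    proof cases
      case 1
      then show ?thesis by (simp add: embed)
    next
      case (2 u u')
      then show ?thesis by (simp add: append embed inv_word_in_words_over)
    qed
  qed
  have "pres_eq X Q v w" using v w cls_eq_iff by metis
  then have "eval_word integer_group ?f v = eval_word integer_group ?f w"
    by (rule Z.eval_word_pres_eq[rotated]) (use rel in auto)
  then show ?thesis unfolding height_def v_def .
qed

lemma height_mult:
  assumes "g \<in> carrier G" "h \<in> carrier G"
  shows "height (g \<otimes>\<^bsub>G\<^esub> h) = height g + height h"
proof -
  interpret Z: group integer_group by simp
  obtain u v where u: "u \<in> words_over X" "g = cls u" and v: "v \<in> words_over X" "h = cls v"
    using carrier_cls assms by meson
  have "g \<otimes>\<^bsub>G\<^esub> h = cls (u @ v)" using u v by (simp add: cls_append)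
  then show ?thesis
    using u v Z.eval_word_append[of X "\<lambda>x. if x = None then 1 else 0" u v] by (simp add: height_cls)
qed

lemma height_emb:
  assumes "h \<in> carrier H" shows "height (emb h) = 0"
proof -
  obtain w where w: "w \<in> words_over S" "val w = h" using val_surj assms by blast
  have "eval_word integer_group (\<lambda>x :: 's option. if x = None then 1 else 0) (embed_word w) = 0"
    by (induction w) (auto simp: embed_word_def)
  then show ?thesis using w emb_val[of w] by (simp add: height_cls)
qed

lemma height_stable: "height stable = 1"
  by (simp add: stable_def height_cls)

lemma stable_pow_conj:
  assumes "h \<in> carrier H"
  shows "\<exists>k\<in>carrier H. stable [^]\<^bsub>G\<^esub> (i::nat) \<otimes>\<^bsub>G\<^esub> emb h = emb k \<otimes>\<^bsub>G\<^esub> stable [^]\<^bsub>G\<^esub> i"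
proof (induction i)
  case 0
  then show ?case using assms by auto
next
  case (Suc i)
  then obtain k where k: "k \<in> carrier H"
    "stable [^]\<^bsub>G\<^esub> i \<otimes>\<^bsub>G\<^esub> emb h = emb k \<otimes>\<^bsub>G\<^esub> stable [^]\<^bsub>G\<^esub> i" by blast
  have comm: "stable \<otimes>\<^bsub>G\<^esub> emb k = emb (\<theta> k) \<otimes>\<^bsub>G\<^esub> stable"
    using k(1) stable_conj[OF k(1), symmetric] by (simp add: G.m_assoc)
  have "stable [^]\<^bsub>G\<^esub> Suc i \<otimes>\<^bsub>G\<^esub> emb h = stable \<otimes>\<^bsub>G\<^esub> (stable [^]\<^bsub>G\<^esub> i \<otimes>\<^bsub>G\<^esub> emb h)"
    using assms by (subst G.nat_pow_Suc2) (simp_all add: G.m_assoc)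
  also have "\<dots> = (stable \<otimes>\<^bsub>G\<^esub> emb k) \<otimes>\<^bsub>G\<^esub> stable [^]\<^bsub>G\<^esub> i"
    unfolding k(2) using k(1) by (simp add: G.m_assoc)
  also have "\<dots> = emb (\<theta> k) \<otimes>\<^bsub>G\<^esub> (stable \<otimes>\<^bsub>G\<^esub> stable [^]\<^bsub>G\<^esub> i)"
    unfolding comm using k(1) by (simp add: G.m_assoc)
  also have "stable \<otimes>\<^bsub>G\<^esub> stable [^]\<^bsub>G\<^esub> i = stable [^]\<^bsub>G\<^esub> Suc i"
    by (rule G.nat_pow_Suc2[symmetric]) simp
  finally show ?case using theta_closed[OF k(1)] by blast
qed

text \<open>Every element has the form \<open>t\<^sup>-\<^sup>i h t\<^sup>j\<close>, because left multiplication by a letter preserves this form.\<close>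

lemma normal_form:
  assumes "w \<in> words_over X"
  shows "\<exists>h\<in>carrier H. \<exists>(i::nat) (j::nat).
    cls w = inv\<^bsub>G\<^esub> (stable [^]\<^bsub>G\<^esub> i) \<otimes>\<^bsub>G\<^esub> emb h \<otimes>\<^bsub>G\<^esub> stable [^]\<^bsub>G\<^esub> j"
  using assms
proof (induction w)
  case Nil
  then show ?case by (intro bexI[of _ \<one>] exI[of _ 0]) (simp_all add: cls_Nil)
next
  case (Cons x w)
  then have w: "w \<in> words_over X" and x: "[x] \<in> words_over X" by auto
  obtain h and i j :: nat where h: "h \<in> carrier H"
    and w_eq: "cls w = inv\<^bsub>G\<^esub> (stable [^]\<^bsub>G\<^esub> i) \<otimes>\<^bsub>G\<^esub> emb h \<otimes>\<^bsub>G\<^esub> stable [^]\<^bsub>G\<^esub> j"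
    using Cons.IH[OF w] by blast
  have step: "cls (x # w) = cls [x] \<otimes>\<^bsub>G\<^esub> cls w" using cls_append[OF x w] by simp
  obtain a b where ab: "x = (a, b)" by (cases x)
  consider (letter) s where "a = Some s" | (up) "a = None" "b" | (down) "a = None" "\<not> b"
    by (cases a) auto
  then show ?case
  proof cases
    case (letter s)
    then have s: "[(s, b)] \<in> words_over S" using x ab by (auto simp: X_def)
    define k where "k = val [(s, b)]"
    have k: "k \<in> carrier H" using s by (simp add: k_def)
    have cls_x: "cls [x] = emb k" using emb_val[OF s] ab letter by (simp add: k_def embed_word_def)
    obtain k' where k': "k' \<in> carrier H"
      "stable [^]\<^bsub>G\<^esub> i \<otimes>\<^bsub>G\<^esub> emb k = emb k' \<otimes>\<^bsub>G\<^esub> stable [^]\<^bsub>G\<^esub> i"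
      using stable_pow_conj[OF k] by blast
    define T where "T = stable [^]\<^bsub>G\<^esub> i"
    have T: "T \<in> carrier G" by (simp add: T_def)
    have "inv\<^bsub>G\<^esub> T \<otimes>\<^bsub>G\<^esub> (T \<otimes>\<^bsub>G\<^esub> emb k) \<otimes>\<^bsub>G\<^esub> inv\<^bsub>G\<^esub> T = inv\<^bsub>G\<^esub> T \<otimes>\<^bsub>G\<^esub> emb k'"
      unfolding k'(2)[folded T_def] using T k'(1) by (simp add: G.m_assoc)
    then have "emb k \<otimes>\<^bsub>G\<^esub> inv\<^bsub>G\<^esub> T = inv\<^bsub>G\<^esub> T \<otimes>\<^bsub>G\<^esub> emb k'"
      using T k by simp
    then have "emb k \<otimes>\<^bsub>G\<^esub> inv\<^bsub>G\<^esub> T \<otimes>\<^bsub>G\<^esub> (emb h \<otimes>\<^bsub>G\<^esub> stable [^]\<^bsub>G\<^esub> j) =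
        inv\<^bsub>G\<^esub> T \<otimes>\<^bsub>G\<^esub> emb k' \<otimes>\<^bsub>G\<^esub> (emb h \<otimes>\<^bsub>G\<^esub> stable [^]\<^bsub>G\<^esub> j)"
      by simp
    then have "cls (x # w) = inv\<^bsub>G\<^esub> T \<otimes>\<^bsub>G\<^esub> emb (k' \<otimes> h) \<otimes>\<^bsub>G\<^esub> stable [^]\<^bsub>G\<^esub> j"
      unfolding step cls_x w_eq T_def[symmetric] using T k k'(1) h by (simp add: G.m_assoc)
    moreover have "k' \<otimes> h \<in> carrier H" using k'(1) h by simp
    ultimately show ?thesis unfolding T_def by blast
  next
    case up
    have cls_x: "cls [x] = stable" using ab up by (simp add: stable_def)
    show ?thesis
    proof (cases i)
      case 0
      have "stable \<otimes>\<^bsub>G\<^esub> emb h = emb (\<theta> h) \<otimes>\<^bsub>G\<^esub> stable"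
        using h stable_conj[OF h, symmetric] by (simp add: G.m_assoc)
      then have "stable \<otimes>\<^bsub>G\<^esub> emb h \<otimes>\<^bsub>G\<^esub> stable [^]\<^bsub>G\<^esub> j = emb (\<theta> h) \<otimes>\<^bsub>G\<^esub> stable \<otimes>\<^bsub>G\<^esub> stable [^]\<^bsub>G\<^esub> j"
        by simp
      then have "cls (x # w) = inv\<^bsub>G\<^esub> (stable [^]\<^bsub>G\<^esub> (0::nat)) \<otimes>\<^bsub>G\<^esub> emb (\<theta> h) \<otimes>\<^bsub>G\<^esub> stable [^]\<^bsub>G\<^esub> Suc j"
        unfolding step cls_x w_eq 0 using h by (subst G.nat_pow_Suc2) (simp_all add: G.m_assoc)
      then show ?thesis using theta_closed[OF h] by blast
    next
      case (Suc i')
      have "cls (x # w) = inv\<^bsub>G\<^esub> (stable [^]\<^bsub>G\<^esub> i') \<otimes>\<^bsub>G\<^esub> emb h \<otimes>\<^bsub>G\<^esub> stable [^]\<^bsub>G\<^esub> j"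
        unfolding step cls_x w_eq Suc using h by (simp add: G.inv_mult_group G.m_assoc)
      then show ?thesis using h by blast
    qed
  next
    case down
    have cls_x: "cls [x] = inv\<^bsub>G\<^esub> stable" using ab down by (simp add: inv_stable)
    have "cls (x # w) = inv\<^bsub>G\<^esub> (stable [^]\<^bsub>G\<^esub> Suc i) \<otimes>\<^bsub>G\<^esub> emb h \<otimes>\<^bsub>G\<^esub> stable [^]\<^bsub>G\<^esub> j"
      unfolding step cls_x w_eq using h by (simp add: G.inv_mult_group G.m_assoc)
    then show ?thesis using h by blast
  qed
qed

lemma stable_inv_conj:
  assumes "h \<in> carrier H"
  shows "inv\<^bsub>G\<^esub> stable \<otimes>\<^bsub>G\<^esub> emb (\<theta> h) \<otimes>\<^bsub>G\<^esub> stable = emb h"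
  unfolding stable_conj[OF assms, symmetric] using assms by (simp add: G.m_assoc)

lemma stable_inv_conj_iff:
  assumes "h \<in> carrier H"
  shows "inv\<^bsub>G\<^esub> stable \<otimes>\<^bsub>G\<^esub> emb h \<otimes>\<^bsub>G\<^esub> stable \<in> emb ` carrier H \<longleftrightarrow> h \<in> B"
proof
  assume "h \<in> B"
  then obtain d where "d \<in> carrier H" "\<theta> d = h" using theta(4) by blast
  then show "inv\<^bsub>G\<^esub> stable \<otimes>\<^bsub>G\<^esub> emb h \<otimes>\<^bsub>G\<^esub> stable \<in> emb ` carrier H"
    using stable_inv_conj[of d] by auto
next
  assume "inv\<^bsub>G\<^esub> stable \<otimes>\<^bsub>G\<^esub> emb h \<otimes>\<^bsub>G\<^esub> stable \<in> emb ` carrier H"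
  then obtain d where d: "d \<in> carrier H"
    "inv\<^bsub>G\<^esub> stable \<otimes>\<^bsub>G\<^esub> emb h \<otimes>\<^bsub>G\<^esub> stable = emb d" by auto
  have "emb (\<theta> d) = emb h"
    unfolding stable_conj[OF d(1), symmetric] d(2)[symmetric] using assms by (simp add: G.m_assoc)
  then have "\<theta> d = h" using emb_inj d(1) assms theta_closed by blast
  then show "h \<in> B" using theta(1)[OF d(1)] by simp
qed

lemma ascending: "ascending_hnn G (emb ` carrier H) stable height p"
proof (intro ascending_hnn.intro ascending_hnn_axioms.intro)
  show "group G" by (rule G.is_group)
  show "subgroup (emb ` carrier H) G" by (rule emb.img_is_subgroup)
  show "stable \<in> carrier G" by simp
  show "prime p" by (rule prime_p)
  show "height stable = 1" by (rule height_stable)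
  show "\<exists>h\<in>emb ` carrier H. inv\<^bsub>G\<^esub> stable \<otimes>\<^bsub>G\<^esub> h \<otimes>\<^bsub>G\<^esub> stable \<notin> emb ` carrier H"
    using B_proper stable_inv_conj_iff by blast
  show "height (g \<otimes>\<^bsub>G\<^esub> h) = height g + height h" if "g \<in> carrier G" "h \<in> carrier G" for g h
    using that by (rule height_mult)
  show "\<exists>h\<in>emb ` carrier H. \<exists>(i::nat) (j::nat). g = inv\<^bsub>G\<^esub> (stable [^]\<^bsub>G\<^esub> i) \<otimes>\<^bsub>G\<^esub> h \<otimes>\<^bsub>G\<^esub> stable [^]\<^bsub>G\<^esub> j"
    if g: "g \<in> carrier G" for g
  proof -
    obtain w where "w \<in> words_over X" "g = cls w" using carrier_cls[OF g] by blast
    then show ?thesis using normal_form[of w] by blast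
  qed
next
  fix h assume "h \<in> emb ` carrier H"
  then obtain a where a: "a \<in> carrier H" "h = emb a" by blast
  show "stable \<otimes>\<^bsub>G\<^esub> h \<otimes>\<^bsub>G\<^esub> inv\<^bsub>G\<^esub> stable \<in> emb ` carrier H"
    unfolding a(2) stable_conj[OF a(1)] using a(1) by simp
  show "height h = 0" unfolding a(2) using a(1) by (rule height_emb)
  have "h [^]\<^bsub>G\<^esub> p = emb (a [^] p)" unfolding a(2) using a(1) by (simp add: emb.hom_nat_pow)
  then show "inv\<^bsub>G\<^esub> stable \<otimes>\<^bsub>G\<^esub> h [^]\<^bsub>G\<^esub> p \<otimes>\<^bsub>G\<^esub> stable \<in> emb ` carrier H"
    using stable_inv_conj_iff[of "a [^] p"] pow_p_in_B[OF a(1)] a(1) by simp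
  fix k assume "k \<in> emb ` carrier H"
  then obtain c where c: "c \<in> carrier H" "k = emb c" by blast
  have "inv\<^bsub>G\<^esub> k \<otimes>\<^bsub>G\<^esub> (stable \<otimes>\<^bsub>G\<^esub> h \<otimes>\<^bsub>G\<^esub> inv\<^bsub>G\<^esub> stable) \<otimes>\<^bsub>G\<^esub> k = emb (inv c \<otimes> \<theta> a \<otimes> c)"
    unfolding a(2) c(2) stable_conj[OF a(1)] using a(1) c(1) by simp
  moreover have "inv c \<otimes> \<theta> a \<otimes> c \<in> B"
    using inv_op_closed1[OF c(1) theta(1)[OF a(1)]] .
  ultimately show "inv\<^bsub>G\<^esub> stable \<otimes>\<^bsub>G\<^esub> (inv\<^bsub>G\<^esub> k \<otimes>\<^bsub>G\<^esub> (stable \<otimes>\<^bsub>G\<^esub> h \<otimes>\<^bsub>G\<^esub> inv\<^bsub>G\<^esub> stable) \<otimes>\<^bsub>G\<^esub> k)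
      \<otimes>\<^bsub>G\<^esub> stable \<in> emb ` carrier H"
    using stable_inv_conj_iff[of "inv c \<otimes> \<theta> a \<otimes> c"] a(1) c(1) by simp
qed

end

section \<open>The bound for the minimal growth rate\<close>

theorem theorem2:
  fixes p :: nat
    and H :: "('h, 'm) monoid_scheme"
    and B :: "'h set"
    and \<theta> :: "'h \<Rightarrow> 'h"
    and S :: "'s set" and R :: "'s gword set" and \<phi> :: "'s gword set \<Rightarrow> 'h"
    and G :: "'s option gword set monoid"
  assumes "prime p"
    and "group H"
    and "B \<lhd> H"
    and "card (rcosets\<^bsub>H\<^esub> B) = p"
    and "\<theta> \<in> iso H (H\<lparr>carrier := B\<rparr>)"
    and "is_presentation S R \<phi> H"
    and "G = hnn_extension S R \<phi> (carrier H) \<theta>"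
    and "finitely_generated G"
  shows "(p = 2 \<longrightarrow> min_growth_rate G \<ge> (1 + sqrt 5) / 2) \<and>
         (\<forall>k. p = 2 * k + 1 \<longrightarrow> min_growth_rate G \<ge> omega_root k)"
proof -
  interpret P: hnn_presentation H B \<theta> p S R \<phi>
    using assms by (intro hnn_presentation.intro hnn_presentation_axioms.intro)
  have G: "G = P.G" using assms(7) P.G_eq by simp
  interpret ascending_hnn P.G "P.emb ` carrier H" P.stable P.height p
    by (rule P.ascending)
  have ne: "fin_gen_sets P.G \<noteq> {}" using assms(8) unfolding finitely_generated_def G .
  show ?thesis
    unfolding G min_growth_rate_def
  proof (intro conjI impI allI)
    show "(INF S\<in>fin_gen_sets P.G. growth_rate P.G S) \<ge> (1 + sqrt 5) / 2" if "p = 2"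
      using that by (intro cINF_greatest[OF ne] growth_rate_bound)
    show "(INF S\<in>fin_gen_sets P.G. growth_rate P.G S) \<ge> omega_root k" if "p = 2 * k + 1" for k
      using that by (intro cINF_greatest[OF ne] growth_rate_bound)
  qed
qed

end
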